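(* Let $X$ be a Euclidean building of type $A_2$ with projective plane at infinity $\mathbb P$, and let $(F_1,F_2,F_3)$, $F_i=(p_i,D_i)$, be a generic triple of flags of $\mathbb P$, with associated flats $A_{ij},A_p$ and points $y_1,y_2,y_3\in A_p$ as defined in the context. For $i\in\mathbb Z/3\mathbb Z$ let $S_i=A_p\cap A_{i,i+1}$, and let $\Delta$ be the triangle in $A_p$ with vertices $y_1,y_2,y_3$. Then (i) $S_i$ is the sector of $A_p$ bounded by the rays from $y_{i+2}$ to $p_i$ and $p_{i+1}$; (ii) $S_1,S_2,S_3$ and $\Delta$ form a partition of $A_p$ (i.e. a covering with disjoint interiors).
   Context: **Model flat.** $\mathbb A=\{\lambda\in\mathbb R^3:\lambda_1+\lambda_2+\lambda_3=0\}$, identified with $\mathbb R^3/\mathbb R(1,1,1)$; $[\lambda]$ is the class of $\lambda\in\mathbb R^3$, and $\varepsilon_1,\varepsilon_2,\varepsilon_3$ is the canonical basis of $\mathbb R^3$. $W=\mathfrak S_3$ acts by permuting coordinates, preserving a Euclidean metric; $W_{aff}$ is the group of all affine isomorphisms of $\mathbb A$ with linear part in $W$. $\mathfrak C=\{\lambda\in\mathbb A:\lambda_1>\lambda_2>\lambda_3\}$. **Euclidean building of type $A_2$.** A CAT(0) metric space $X$ with a maximal collection of isometric embeddings $f:\mathbb A\to X$ (marked flats) such that: (A1) the collection is invariant under precomposition by $W_{aff}$; (A2) for marked flats $f,f'$, the transition map $f^{-1}\circ f'$ is the restriction of an element of $W_{aff}$; (A3') any two rays of $X$ are initially contained in a common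 marked flat. Flats and Weyl chambers are the images of $\mathbb A$ and $\mathfrak C$ under marked flats. **Infinity.** The CAT(0) boundary $\partial_\infty X$ is a spherical building whose chambers (ideal chambers) and apartments are the boundaries of Weyl chambers and of flats. It is the incidence graph of a projective plane $\mathbb P$: points of $\mathbb P$ are the ideal points of rays of type $[\varepsilon_1]$ (images under marked flats of rays of direction in $W[\varepsilon_1]$), lines are the ideal points of rays of type $[\varepsilon_1+\varepsilon_2]$, and $p\in D$ iff $p,D$ are the vertices of a common ideal chamber. Ideal chambers are thus flags $(p,D)$. Flags $(p,D),(p',D')$ are opposite iff $p\notin D'$ and $p'\notin D$; then a unique flat $A(F,F')$ contains both in its boundary. Three noncollinear points lie in the boundary of a unique flat. The sector bounded by two rays from $y$ in a flat is the closed convex cone of that flat with apex $y$ generated by these rays; triangles are filled (convex hulls of their vertices in the flat), possibly reduced to a point. **Triples, flats and points.** Indices are in $\mathbb Z/3\mathbb Z$. A triple of flags $F_i=(p_i,D_i)$ is generic if the flags are pairwise opposite, the $p_i$ are not collinear and the $D_i$ not concurrent. $A_{ij}=A(F_i,F_j)$ and $A_p$ is the flat with $p_1,p_2,p_3$ in its boundary. For $\{i,j,k\}=\{1,2,3\}$, let $p_{ij}=D_i\cap D_j$. The point $y_k$ is the center of the projective frame $(p_1,p_2,p_3,p_{ij})$, i.e. the unique point common to the four flats determined by three of these four points; in particular $y_k\in A_p\cap A_{ij}$. *)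

theory Defs
  imports "HOL-Analysis.Analysis"
begin

section \<open>CAT(0) spaces and their ideal points\<close>

definition geodesic_segment :: "(real \<Rightarrow> 'a::metric_space) \<Rightarrow> 'a \<Rightarrow> 'a \<Rightarrow> bool" where
  "geodesic_segment c x y \<longleftrightarrow> c 0 = x \<and> c (dist x y) = y \<and>
     (\<forall>s\<in>{0..dist x y}. \<forall>t\<in>{0..dist x y}. dist (c s) (c t) = \<bar>s - t\<bar>)"

text \<open>Two distinct sides of a geodesic triangle always share a vertex, here called \<open>x\<close>, so it
  suffices to compare points on the two sides issuing from \<open>x\<close>. The points \<open>x', y', z'\<close> are the
  vertices of a comparison triangle in the Euclidean plane.\<close>

definition CAT0 :: "'a::metric_space itself \<Rightarrow> bool" where
  "CAT0 _ \<longleftrightarrow>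
     (\<forall>x y::'a. \<exists>c. geodesic_segment c x y) \<and>
     (\<forall>(x::'a) y z c c' (x'::real^2) y' z' s t.
        geodesic_segment c x y \<and> geodesic_segment c' x z \<and>
        dist x' y' = dist x y \<and> dist x' z' = dist x z \<and> dist y' z' = dist y z \<and>
        s \<in> {0..1} \<and> t \<in> {0..1} \<longrightarrow>
        dist (c (s * dist x y)) (c' (t * dist x z))
          \<le> dist (x' + s *\<^sub>R (y' - x')) (x' + t *\<^sub>R (z' - x')))"

text \<open>Only the values at nonnegative times of a ray are constrained, or matter.\<close>

definition ray :: "(real \<Rightarrow> 'a::metric_space) \<Rightarrow> bool" where
  "ray r \<longleftrightarrow> (\<forall>s\<ge>0. \<forall>t\<ge>0. dist (r s) (r t) = \<bar>s - t\<bar>)"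

definition asymptotic :: "(real \<Rightarrow> 'a::metric_space) \<Rightarrow> (real \<Rightarrow> 'a) \<Rightarrow> bool" where
  "asymptotic r r' \<longleftrightarrow> (\<exists>K. \<forall>t\<ge>0. dist (r t) (r' t) \<le> K)"

type_synonym 'a ideal_pt = "(real \<Rightarrow> 'a) set"

definition ideal_point :: "(real \<Rightarrow> 'a::metric_space) \<Rightarrow> 'a ideal_pt" where
  "ideal_point r = {r'. ray r' \<and> asymptotic r r'}"

definition boundary :: "'a::metric_space set \<Rightarrow> 'a ideal_pt set" where
  "boundary S = {ideal_point r | r. ray r \<and> r ` {0..} \<subseteq> S}"


section \<open>The model flat\<close>

definition model_flat :: "(real^3) set" where
  "model_flat = {v. v$1 + v$2 + v$3 = 0}"

text \<open>The representative in \<^const>\<open>model_flat\<close> of the class of \<open>v\<close> modulo \<open>(1,1,1)\<close>.\<close>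

definition cls :: "real^3 \<Rightarrow> real^3" where
  "cls v = v - ((v$1 + v$2 + v$3) / 3) *\<^sub>R 1"

definition coord_perm :: "(3 \<Rightarrow> 3) \<Rightarrow> real^3 \<Rightarrow> real^3" where
  "coord_perm \<sigma> v = (\<chi> i. v $ \<sigma> i)"

definition Weyl_group :: "(real^3 \<Rightarrow> real^3) set" where
  "Weyl_group = {coord_perm \<sigma> | \<sigma>. bij \<sigma>}"

text \<open>All translations of the model flat are allowed, not only those of a lattice.\<close>

definition affine_Weyl_group :: "(real^3 \<Rightarrow> real^3) set" where
  "affine_Weyl_group = {\<lambda>v. w v + b | w b. w \<in> Weyl_group \<and> b \<in> model_flat}"

definition model_chamber :: "(real^3) set" where
  "model_chamber = {v \<in> model_flat. v$1 > v$2 \<and> v$2 > v$3}"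


section \<open>Euclidean buildings of type \<open>A\<^sub>2\<close>\<close>

text \<open>The model flat carries the metric induced by \<^typ>\<open>real^3\<close>: the Euclidean metrics
  invariant under the Weyl group are its multiples. Maps defined on the model flat are made
  extensional, so that their equality is equality on the model flat.\<close>

definition isometric_embedding :: "(real^3 \<Rightarrow> 'a::metric_space) \<Rightarrow> bool" where
  "isometric_embedding f \<longleftrightarrow> f \<in> extensional model_flat \<and>
     (\<forall>a\<in>model_flat. \<forall>b\<in>model_flat. dist (f a) (f b) = dist a b)"

definition flat_axioms :: "(real^3 \<Rightarrow> 'a::metric_space) set \<Rightarrow> bool" where
  "flat_axioms \<F> \<longleftrightarrow>
     (\<forall>f\<in>\<F>. isometric_embedding f) \<and>
     (\<forall>f\<in>\<F>. \<forall>w\<in>affine_Weyl_group. restrict (f \<circ> w) model_flat \<in> \<F>) \<and>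
     (\<forall>f\<in>\<F>. \<forall>f'\<in>\<F>. \<exists>w\<in>affine_Weyl_group.
        \<forall>a\<in>model_flat. \<forall>b\<in>model_flat. f a = f' b \<longrightarrow> a = w b) \<and>
     (\<forall>r r'. ray r \<and> ray r' \<longrightarrow>
        (\<exists>f\<in>\<F>. \<exists>e>0. r ` {0..e} \<union> r' ` {0..e} \<subseteq> f ` model_flat))"

definition euclidean_building_A2 :: "(real^3 \<Rightarrow> 'a::metric_space) set \<Rightarrow> bool" where
  "euclidean_building_A2 \<F> \<longleftrightarrow> CAT0 TYPE('a) \<and> flat_axioms \<F> \<and>
     (\<forall>\<F>'. flat_axioms \<F>' \<and> \<F> \<subseteq> \<F>' \<longrightarrow> \<F>' = \<F>)"

definition flats :: "(real^3 \<Rightarrow> 'a::metric_space) set \<Rightarrow> 'a set set" where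
  "flats \<F> = {f ` model_flat | f. f \<in> \<F>}"

definition Weyl_chambers :: "(real^3 \<Rightarrow> 'a::metric_space) set \<Rightarrow> 'a set set" where
  "Weyl_chambers \<F> = {f ` model_chamber | f. f \<in> \<F>}"


section \<open>The projective plane at infinity\<close>

definition flat_ray :: "(real^3 \<Rightarrow> 'a::metric_space) \<Rightarrow> real^3 \<Rightarrow> real^3 \<Rightarrow> real \<Rightarrow> 'a" where
  "flat_ray f a u = (\<lambda>t. f (a + t *\<^sub>R sgn u))"

definition ideal_points_of_type ::
    "(real^3 \<Rightarrow> 'a::metric_space) set \<Rightarrow> real^3 \<Rightarrow> 'a ideal_pt set" where
  "ideal_points_of_type \<F> v =
     {ideal_point (flat_ray f a (w (cls v))) | f a w.
        f \<in> \<F> \<and> a \<in> model_flat \<and> w \<in> Weyl_group}"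

definition proj_points :: "(real^3 \<Rightarrow> 'a::metric_space) set \<Rightarrow> 'a ideal_pt set" where
  "proj_points \<F> = ideal_points_of_type \<F> (axis 1 1)"

definition proj_lines :: "(real^3 \<Rightarrow> 'a::metric_space) set \<Rightarrow> 'a ideal_pt set" where
  "proj_lines \<F> = ideal_points_of_type \<F> (axis 1 1 + axis 2 1)"

definition ideal_chambers :: "(real^3 \<Rightarrow> 'a::metric_space) set \<Rightarrow> 'a ideal_pt set set" where
  "ideal_chambers \<F> = boundary ` Weyl_chambers \<F>"

text \<open>The boundary of a Weyl chamber contains its two vertices, since a translate of a wall of the
  model chamber lies in the open chamber; they are its only elements of the two vertex types.\<close>

definition incident ::
    "(real^3 \<Rightarrow> 'a::metric_space) set \<Rightarrow> 'a ideal_pt \<Rightarrow> 'a ideal_pt \<Rightarrow> bool" where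
  "incident \<F> p D \<longleftrightarrow> p \<in> proj_points \<F> \<and> D \<in> proj_lines \<F> \<and>
     (\<exists>c\<in>ideal_chambers \<F>. p \<in> c \<and> D \<in> c)"

definition points_on :: "(real^3 \<Rightarrow> 'a::metric_space) set \<Rightarrow> 'a ideal_pt \<Rightarrow> 'a ideal_pt set" where
  "points_on \<F> D = {p. incident \<F> p D}"

type_synonym 'a flag = "'a ideal_pt \<times> 'a ideal_pt"

definition flags :: "(real^3 \<Rightarrow> 'a::metric_space) set \<Rightarrow> 'a flag set" where
  "flags \<F> = {(p, D). incident \<F> p D}"

definition opposite ::
    "(real^3 \<Rightarrow> 'a::metric_space) set \<Rightarrow> 'a flag \<Rightarrow> 'a flag \<Rightarrow> bool" where
  "opposite \<F> F F' \<longleftrightarrow> \<not> incident \<F> (fst F) (snd F') \<and> \<not> incident \<F> (fst F') (snd F)"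

definition generic_triple ::
    "(real^3 \<Rightarrow> 'a::metric_space) set \<Rightarrow> (3 \<Rightarrow> 'a flag) \<Rightarrow> bool" where
  "generic_triple \<F> F \<longleftrightarrow>
     (\<forall>i. F i \<in> flags \<F>) \<and>
     (\<forall>i j. i \<noteq> j \<longrightarrow> opposite \<F> (F i) (F j)) \<and>
     \<not> (\<exists>L\<in>proj_lines \<F>. \<forall>i. incident \<F> (fst (F i)) L) \<and>
     \<not> (\<exists>x\<in>proj_points \<F>. \<forall>i. incident \<F> x (snd (F i)))"


section \<open>Flats, centers, sectors and convex hulls\<close>

text \<open>An apartment containing both vertices of an ideal chamber contains that chamber.\<close>

definition flat_joining ::
    "(real^3 \<Rightarrow> 'a::metric_space) set \<Rightarrow> 'a flag \<Rightarrow> 'a flag \<Rightarrow> 'a set \<Rightarrow> bool" where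
  "flat_joining \<F> F F' A \<longleftrightarrow>
     A \<in> flats \<F> \<and> {fst F, snd F, fst F', snd F'} \<subseteq> boundary A"

definition flat_through ::
    "(real^3 \<Rightarrow> 'a::metric_space) set \<Rightarrow> 'a ideal_pt set \<Rightarrow> 'a set \<Rightarrow> bool" where
  "flat_through \<F> T A \<longleftrightarrow> A \<in> flats \<F> \<and> T \<subseteq> boundary A"

text \<open>\<open>Q\<close> is the set of the four points of a projective frame.\<close>

definition frame_center ::
    "(real^3 \<Rightarrow> 'a::metric_space) set \<Rightarrow> 'a ideal_pt set \<Rightarrow> 'a \<Rightarrow> bool" where
  "frame_center \<F> Q y \<longleftrightarrow>
     \<Inter>{A. \<exists>T\<subseteq>Q. card T = 3 \<and> flat_through \<F> T A} = {y}"

text \<open>Neither of the next two sets depends on the marking \<open>f\<close> of the flat \<open>A\<close>. In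
  \<open>sector\<close>, \<open>u\<close> and \<open>v\<close> are the directions, in a marking sending \<open>a\<close> to \<open>y\<close>, of the rays from
  \<open>y\<close> to \<open>\<xi>\<close> and \<open>\<eta>\<close>.\<close>

definition sector ::
    "(real^3 \<Rightarrow> 'a::metric_space) set \<Rightarrow> 'a set \<Rightarrow> 'a \<Rightarrow> 'a ideal_pt \<Rightarrow> 'a ideal_pt \<Rightarrow> 'a set" where
  "sector \<F> A y \<xi> \<eta> =
     {f (a + s *\<^sub>R u + t *\<^sub>R v) | f a u v s t.
        f \<in> \<F> \<and> f ` model_flat = A \<and>
        a \<in> model_flat \<and> u \<in> model_flat \<and> v \<in> model_flat \<and> f a = y \<and>
        flat_ray f a u \<in> \<xi> \<and> flat_ray f a v \<in> \<eta> \<and> 0 \<le> s \<and> 0 \<le> t}"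

definition flat_hull ::
    "(real^3 \<Rightarrow> 'a::metric_space) set \<Rightarrow> 'a set \<Rightarrow> 'a set \<Rightarrow> 'a set" where
  "flat_hull \<F> A T =
     {f b | f b. f \<in> \<F> \<and> f ` model_flat = A \<and> b \<in> convex hull {a \<in> model_flat. f a \<in> T}}"

end

theory Submission
  imports Defs
begin

text \<open>Both assertions follow from asymptotic rays alone. In a CAT(0) space a ray is determined by its
  origin and its ideal point, so two flats sharing a point \<open>y\<close> and two ideal points share the cone
  from \<open>y\<close> spanned by them. For a frame \<open>(a, b, c, d)\<close> with center \<open>y\<close>, each triple of its points
  therefore spans a flat that is a union of three such cones; a point of \<open>A\<^sub>a\<^sub>b\<^sub>c \<inter> A\<^sub>a\<^sub>b\<^sub>d\<close> outside
  the cone of \<open>a, b\<close> would, say, lie both in the cone of \<open>a, c\<close> and in that of \<open>a, d\<close>, but off the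
  ray to \<open>a\<close>, which is all these two cones of \<open>A\<^sub>a\<^sub>c\<^sub>d\<close> have in common. This gives (i).

  For (ii), compare \<open>A\<^sub>1\<^sub>3\<close> with the flat through \<open>p\<^sub>1, p\<^sub>3, p\<^sub>2\<^sub>3\<close>: in both, \<open>D\<^sub>3\<close> is opposite to
  \<open>p\<^sub>1\<close>, so from a common point they share a half-plane, and hence leave \<open>A\<^sub>p\<close> along the same line of
  direction \<open>p\<^sub>3\<close>. So \<open>y\<^sub>1\<close> and \<open>y\<^sub>2\<close> lie on a line of direction \<open>p\<^sub>3\<close>, and likewise for the other
  indices; the rest is plane geometry.\<close>

section \<open>Comparison geometry of CAT(0) spaces\<close>

text \<open>The obstacle is that the spherical building at infinity is not given: there are only
  charts in a CAT(0) space, so types, incidence and joining lines must be extracted from asymptotic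
  rays lying in different flats. An ideal point has the same type in all flats because asymptotic
  rays of different types would have a squared distance that is uniformly convex, yet bounded.
  Incidence is an angle at infinity, pi / 3 as against pi, and such angles are the same in all
  flats. Two points determine their line by the Bruhat-Tits inequality. Nor are all flats given:
  only those through \<open>p 1, p 2, p 3\<close> and those joining two flags. The other flats of a
  frame exist because otherwise the intersection defining its center would be larger than a point.
  In (ii) the comparison of the two flats is symmetric, which gives opposite inequalities and so the
  common line. The three differences of the \<open>y k\<close> then close up along three directions
  of sum 0, so one signed length \<open>\<tau>\<close> describes the whole triangle. Its sign is not
  determined, hence the tiling is treated for both orientations and for \<open>\<tau> = 0\<close> at
  once.\<close>

lemma comparison_triangle:
  fixes a b c :: real
  assumes "0 \<le> a" "0 \<le> b" "c \<le> a + b" "a \<le> b + c" "b \<le> a + c"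
  shows "\<exists>x y z :: real^2. dist x y = a \<and> dist x z = b \<and> dist y z = c"
proof (cases "a = 0")
  case True
  then have "c = b" using assms by auto
  then show ?thesis using True assms
    by (intro exI[of _ 0] exI[of _ 0] exI[of _ "axis 1 b"] conjI) (simp_all add: dist_norm norm_vec_def L2_set_def sum_2 axis_def)
next
  case False
  \<comment> \<open>Law of cosines: with the side of length \<open>a\<close> on the first axis,
    \<open>u\<close> and \<open>v\<close> are the coordinates of the third vertex.\<close>
  define u where "u = (a\<^sup>2 + b\<^sup>2 - c\<^sup>2) / (2 * a)"
  have "\<bar>u\<bar> \<le> b"
  proof -
    have "(a - b)\<^sup>2 \<le> c\<^sup>2" using assms by (intro power2_le_iff_abs_le[THEN iffD2]) auto
    moreover have "c\<^sup>2 \<le> (a + b)\<^sup>2" using assms by (intro power_mono) auto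
    ultimately show ?thesis
      using False assms unfolding u_def
      by (auto simp: abs_le_iff divide_simps power2_eq_square algebra_simps)
  qed
  then have "u\<^sup>2 \<le> b\<^sup>2" by (simp add: abs_le_square_iff[symmetric])
  define v where "v = sqrt (b\<^sup>2 - u\<^sup>2)"
  have v: "v\<^sup>2 = b\<^sup>2 - u\<^sup>2" using \<open>u\<^sup>2 \<le> b\<^sup>2\<close> by (simp add: v_def)
  have e: "(a - u)\<^sup>2 + v\<^sup>2 = c\<^sup>2" using False unfolding v u_def
    by (simp add: field_simps power2_eq_square)
  have "0 \<le> c" using assms by auto
  have "dist (0::real^2) (vector [a, 0]) = a" "dist (0::real^2) (vector [u, v]) = b"
    "dist (vector [a, 0]::real^2) (vector [u, v]) = c"
    using assms e v \<open>0 \<le> c\<close> by (auto simp: dist_norm norm_vec_def L2_set_def sum_2)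
  then show ?thesis by blast
qed

text \<open>\<open>CAT0\<close> quantifies over all comparison triangles in the plane; exhibiting
  one for every geodesic triangle keeps the comparison from being vacuous.\<close>

lemma CAT0_comparison:
  fixes x y z :: "'a::metric_space"
  assumes "CAT0 TYPE('a)" "geodesic_segment c x y" "geodesic_segment c' x z"
  obtains x' y' z' :: "real^2" where "dist x' y' = dist x y" "dist x' z' = dist x z" "dist y' z' = dist y z"
    "\<And>s t. s \<in> {0..1} \<Longrightarrow> t \<in> {0..1} \<Longrightarrow> dist (c (s * dist x y)) (c' (t * dist x z))
          \<le> dist (x' + s *\<^sub>R (y' - x')) (x' + t *\<^sub>R (z' - x'))"
proof -
  obtain x' y' z' :: "real^2" where d: "dist x' y' = dist x y" "dist x' z' = dist x z" "dist y' z' = dist y z"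
    using comparison_triangle[of "dist x y" "dist x z" "dist y z"]
    by (metis dist_triangle dist_triangle2 dist_triangle3 zero_le_dist dist_commute)
  show ?thesis
    by (rule that[OF d]) (use assms d in \<open>unfold CAT0_def, blast\<close>)
qed

text \<open>At equal fractions of the two sides, the comparison points cut off a homothetic
  triangle, whose base is \<open>s\<close> times the opposite side.\<close>

lemma CAT0_hinge:
  fixes x y z :: "'a::metric_space"
  assumes "CAT0 TYPE('a)" "geodesic_segment c x y" "geodesic_segment c' x z" "0 \<le> s" "s \<le> 1"
  shows "dist (c (s * dist x y)) (c' (s * dist x z)) \<le> s * dist y z"
proof -
  obtain x' y' z' :: "real^2" where d: "dist y' z' = dist y z"
    "dist (c (s * dist x y)) (c' (s * dist x z)) \<le> dist (x' + s *\<^sub>R (y' - x')) (x' + s *\<^sub>R (z' - x'))"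
    using CAT0_comparison[OF assms(1-3)] assms(4,5) by (metis atLeastAtMost_iff)
  have "dist (x' + s *\<^sub>R (y' - x')) (x' + s *\<^sub>R (z' - x')) = norm (s *\<^sub>R (y' - z'))"
    by (simp add: dist_norm algebra_simps)
  then show ?thesis using d assms by (simp add: dist_norm)
qed

lemma CAT0_geodesic_unique:
  fixes x y :: "'a::metric_space"
  assumes "CAT0 TYPE('a)" "geodesic_segment c x y" "geodesic_segment c' x y" "0 \<le> s" "s \<le> 1"
  shows "c (s * dist x y) = c' (s * dist x y)"
  using CAT0_hinge[OF assms] by simp

text \<open>The Bruhat-Tits inequality: the midpoint of one side is compared with the end
  \<open>z\<close> of the other (fraction 1), where the Euclidean value comes from the parallelogram
  law.\<close>

lemma CAT0_midpoint:
  fixes x y z :: "'a::metric_space"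
  assumes "CAT0 TYPE('a)" "geodesic_segment c x y"
  shows "(dist (c (dist x y / 2)) z)\<^sup>2 \<le> ((dist x z)\<^sup>2 + (dist y z)\<^sup>2) / 2 - (dist x y)\<^sup>2 / 4"
proof -
  obtain c' where c': "geodesic_segment c' x z" using assms unfolding CAT0_def by blast
  obtain x' y' z' :: "real^2" where d: "dist x' y' = dist x y" "dist x' z' = dist x z" "dist y' z' = dist y z"
    "dist (c ((1/2) * dist x y)) (c' (1 * dist x z)) \<le> dist (x' + (1/2) *\<^sub>R (y' - x')) (x' + 1 *\<^sub>R (z' - x'))"
    by (rule CAT0_comparison[OF assms c']) (metis atLeastAtMost_iff zero_le_one order_refl
        half_gt_zero_iff less_imp_le divide_le_eq_1_pos one_le_numeral zero_less_numeral zero_le_divide_1_iff zero_le_numeral)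
  have z: "c' (dist x z) = z" using c' by (simp add: geodesic_segment_def)
  have "(dist (x' + (1/2) *\<^sub>R (y' - x')) z')\<^sup>2 = ((dist x' z')\<^sup>2 + (dist y' z')\<^sup>2) / 2 - (dist x' y')\<^sup>2 / 4"
    by (simp add: dist_norm power2_norm_eq_inner inner_simps inner_commute field_simps)
  moreover have "(dist (c (dist x y / 2)) z)\<^sup>2 \<le> (dist (x' + (1/2) *\<^sub>R (y' - x')) z')\<^sup>2"
    using d(4) z by (intro power_mono) auto
  ultimately show ?thesis using d by simp
qed

section \<open>Distances between rays, and asymptotic rays\<close>

lemma ray_geodesic:
  assumes "ray r" "0 \<le> a" "a \<le> b"
  shows "geodesic_segment (\<lambda>s. r (a + s)) (r a) (r b)" "geodesic_segment (\<lambda>s. r (b - s)) (r b) (r a)"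
    "dist (r a) (r b) = b - a"
  using assms by (auto simp: ray_def geodesic_segment_def)

lemma convex_dist_rays:
  fixes r r' :: "real \<Rightarrow> 'a::metric_space"
  assumes "CAT0 TYPE('a)" "ray r" "ray r'"
  shows "convex_on {0..} (\<lambda>t. dist (r t) (r' t))"
proof (rule convex_on_linorderI)
  fix t x y :: real
  assume t: "0 < t" "t < 1" and xy: "x \<in> {0..}" "y \<in> {0..}" "x < y"
  \<comment> \<open>A diagonal of the quadrilateral between the two rays; the hinge inequality is
    applied to the triangles on both of its sides, at opposite ends.\<close>
  obtain c where c: "geodesic_segment c (r x) (r' y)" using assms unfolding CAT0_def by blast
  let ?d = "dist (r x) (r' y)"
  have c': "geodesic_segment (\<lambda>s. c (?d - s)) (r' y) (r x)"
    using c by (auto simp: geodesic_segment_def dist_commute)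
  have 1: "dist (r (x + t * (y - x))) (c (t * ?d)) \<le> t * dist (r y) (r' y)"
    using CAT0_hinge[OF assms(1) ray_geodesic(1)[OF assms(2), of x y] c, of t] xy t
    by (simp add: ray_geodesic[OF assms(2)])
  have "dist (r' (y - (1-t) * (y - x))) (c (?d - (1-t) * ?d)) \<le> (1-t) * dist (r' x) (r x)"
    using CAT0_hinge[OF assms(1) ray_geodesic(2)[OF assms(3), of x y] c', of "1-t"] xy t
    by (simp add: ray_geodesic[OF assms(3)] dist_commute)
  moreover have "?d - (1-t) * ?d = t * ?d" "y - (1-t) * (y - x) = x + t * (y - x)"
    by (simp_all add: algebra_simps)
  ultimately have 2: "dist (c (t * ?d)) (r' (x + t * (y - x))) \<le> (1-t) * dist (r x) (r' x)"
    by (metis dist_commute)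
  have e: "(1 - t) *\<^sub>R x + t *\<^sub>R y = x + t * (y - x)" by (simp add: algebra_simps)
  then show "dist (r ((1 - t) *\<^sub>R x + t *\<^sub>R y)) (r' ((1 - t) *\<^sub>R x + t *\<^sub>R y))
       \<le> (1 - t) * dist (r x) (r' x) + t * dist (r y) (r' y)"
    unfolding e using 1 2 dist_triangle[of "r (x + t * (y - x))" "r' (x + t * (y - x))" "c (t * ?d)"] by linarith
qed auto

text \<open>\<open>\<phi> t\<close> lies below the chord from 0 to \<open>T\<close>, and sublinear
  growth makes the value of that chord at \<open>t\<close> tend to \<open>\<phi> 0\<close>. Besides
  bounded distances this covers the square-root growth met in
  \<open>line_through_points_unique\<close>.\<close>

lemma convex_sublinear_le:
  fixes \<phi> :: "real \<Rightarrow> real"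
  assumes \<phi>: "convex_on {0..} \<phi>" and lim: "((\<lambda>t. \<phi> t / t) \<longlongrightarrow> 0) at_top" and "0 \<le> t"
  shows "\<phi> t \<le> \<phi> 0"
proof (rule tendsto_lowerbound)
  have z: "((\<lambda>T. t / T) \<longlongrightarrow> 0) at_top"
    by (intro tendsto_divide_0[OF tendsto_const] filterlim_at_top_imp_at_infinity filterlim_ident)
  have "((\<lambda>T. (1 - t / T) * \<phi> 0 + t * (\<phi> T / T)) \<longlongrightarrow> (1 - 0) * \<phi> 0 + t * 0) at_top"
    by (intro tendsto_intros lim z)
  then show "((\<lambda>T. (1 - t / T) * \<phi> 0 + t * (\<phi> T / T)) \<longlongrightarrow> \<phi> 0) at_top" by simp
  show "\<forall>\<^sub>F T in at_top. \<phi> t \<le> (1 - t / T) * \<phi> 0 + t * (\<phi> T / T)"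
    using eventually_gt_at_top[of t]
  proof eventually_elim
    case (elim T)
    then have "\<phi> ((1 - t/T) *\<^sub>R 0 + (t/T) *\<^sub>R T) \<le> (1 - t/T) * \<phi> 0 + (t/T) * \<phi> T"
      using \<open>0 \<le> t\<close> by (intro convex_onD[OF \<phi>]) auto
    then show ?case using elim \<open>0 \<le> t\<close> by simp
  qed
qed simp

lemma asymptotic_refl: "asymptotic r r"
  by (auto simp: asymptotic_def)

lemma asymptotic_sym: "asymptotic r r' \<Longrightarrow> asymptotic r' r"
  by (simp add: asymptotic_def dist_commute)

lemma asymptotic_trans:
  assumes "asymptotic r r'" "asymptotic r' r''" shows "asymptotic r r''"
proof -
  obtain K L where "\<forall>t\<ge>0. dist (r t) (r' t) \<le> K" "\<forall>t\<ge>0. dist (r' t) (r'' t) \<le> L"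
    using assms unfolding asymptotic_def by blast
  then have "\<forall>t\<ge>0. dist (r t) (r'' t) \<le> K + L" by (meson add_mono dist_triangle order_trans)
  then show ?thesis unfolding asymptotic_def by blast
qed

lemma ideal_point_eq_iff: "ray r \<Longrightarrow> ideal_point r = ideal_point r' \<longleftrightarrow> ray r \<and> asymptotic r r'"
  unfolding ideal_point_def using asymptotic_refl asymptotic_sym asymptotic_trans by blast

lemma dist_asymptotic_le:
  fixes r r' :: "real \<Rightarrow> 'a::metric_space"
  assumes "CAT0 TYPE('a)" "ray r" "ray r'" "asymptotic r r'" "0 \<le> t"
  shows "dist (r t) (r' t) \<le> dist (r 0) (r' 0)"
proof (rule convex_sublinear_le[OF convex_dist_rays[OF assms(1-3)] _ \<open>0 \<le> t\<close>])
  obtain K where K: "\<forall>t\<ge>0. dist (r t) (r' t) \<le> K" using assms unfolding asymptotic_def by blast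
  show "((\<lambda>t. dist (r t) (r' t) / t) \<longlongrightarrow> 0) at_top"
  proof (rule tendsto_sandwich)
    show "\<forall>\<^sub>F t in at_top. 0 \<le> dist (r t) (r' t) / t" using eventually_gt_at_top[of 0] by eventually_elim auto
    show "\<forall>\<^sub>F t in at_top. dist (r t) (r' t) / t \<le> K / t"
      using eventually_gt_at_top[of 0] by eventually_elim (use K in \<open>simp add: divide_right_mono\<close>)
    show "((\<lambda>t::real. K / t) \<longlongrightarrow> 0) at_top"
      by (intro tendsto_divide_0[OF tendsto_const] filterlim_at_top_imp_at_infinity filterlim_ident)
  qed simp
qed

lemma asymptotic_rays_eq:
  fixes r r' :: "real \<Rightarrow> 'a::metric_space"
  assumes "CAT0 TYPE('a)" "ray r" "ray r'" "asymptotic r r'" "r 0 = r' 0" "0 \<le> t"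
  shows "r t = r' t"
  using dist_asymptotic_le[OF assms(1-4,6)] assms(5) by simp

section \<open>The model flat\<close>

text \<open>The coefficient \<open>B t\<close> is a right derivative: it is nonpositive, yet grows
  at rate at least \<open>2 * \<delta>\<close>, which cannot go on forever. The expansions hold only
  to the right of each \<open>t\<close> and without a lower bound on \<open>e\<close>, so the growth
  is propagated by a supremum argument.\<close>

lemma no_bounded_uniformly_convex:
  fixes \<psi> :: "real \<Rightarrow> real"
  assumes convex: "convex_on {0..} \<psi>" and le: "\<And>s t. 0 \<le> s \<Longrightarrow> s \<le> t \<Longrightarrow> \<psi> t \<le> \<psi> s"
    and "0 < \<delta>"
    and quad: "\<And>t. 0 \<le> t \<Longrightarrow> \<exists>e>0. \<exists>B C. \<delta> \<le> C \<and> (\<forall>s\<in>{0..e}. \<psi> (t + s) = \<psi> t + B * s + C * s\<^sup>2)"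
  shows False
proof -
  obtain e B C where e: "\<And>t. 0 \<le> t \<Longrightarrow> 0 < e t" and C: "\<And>t. 0 \<le> t \<Longrightarrow> \<delta> \<le> C t"
    and \<psi>: "\<And>t s. 0 \<le> t \<Longrightarrow> 0 \<le> s \<Longrightarrow> s \<le> e t \<Longrightarrow> \<psi> (t + s) = \<psi> t + B t * s + C t * s\<^sup>2"
    using quad by (metis atLeastAtMost_iff)
  have Cpos: "0 < C t" if "0 \<le> t" for t using C[OF that] \<open>0 < \<delta>\<close> by simp
  \<comment> \<open>The slope of \<open>\<psi>\<close> over an interval of length \<open>s\<close>
    exceeds \<open>B\<close> by \<open>C * s\<close>; this absorbs that error.\<close>
  have eps: "x \<le> y" if "0 \<le> t" "0 < d" "\<And>s. 0 < s \<Longrightarrow> s \<le> e t \<Longrightarrow> s \<le> d \<Longrightarrow> x \<le> y + C t * s" for x y t d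
  proof (rule field_le_epsilon)
    fix \<epsilon> :: real assume "0 < \<epsilon>"
    define s where "s = min (min d (e t)) (\<epsilon> / C t)"
    have "0 < s" "s \<le> d" "s \<le> e t" "s \<le> \<epsilon> / C t"
      using that(1,2) e[OF that(1)] Cpos[OF that(1)] \<open>0 < \<epsilon>\<close> by (auto simp: s_def)
    then show "x \<le> y + \<epsilon>" using that(3)[of s] Cpos[OF that(1)] by (simp add: field_simps)
  qed
  have mono: "B t \<le> B t'" if t: "0 \<le> t" "t < t'" for t t'
  proof (rule eps[where d = 1])
    fix s' assume s': "0 < s'" "s' \<le> e t'"
    \<comment> \<open>Short enough for the expansion at \<open>t\<close> and for three consecutive
      chords, ending at \<open>t + s\<close>, \<open>t'\<close> and \<open>t' + s'\<close>, whose
      slopes increase by convexity.\<close>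
    define s where "s = min (e t) ((t' - t) / 2)"
    have s: "0 < s" "s \<le> e t" "t + s < t'" using t e[of t] by (auto simp: s_def min_def field_simps)
    have "(\<psi> t - \<psi> (t + s)) / (t - (t + s)) \<le> (\<psi> (t + s) - \<psi> t') / ((t + s) - t')"
      using convex_on_slope_le[OF convex, of t t' "t + s"] s t by auto
    also have "\<dots> \<le> (\<psi> t' - \<psi> (t' + s')) / (t' - (t' + s'))"
      using convex_on_slope_le[OF convex, of "t + s" "t' + s'" t'] s s' t by auto
    also have "\<dots> = B t' + C t' * s'"
      using \<psi>[of t' s'] s' t by (simp add: field_simps power2_eq_square)
    also have "(\<psi> t - \<psi> (t + s)) / (t - (t + s)) = B t + C t * s"
      using \<psi>[of t s] s t by (simp add: field_simps power2_eq_square)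
    finally show "B t \<le> B t' + C t' * s'" using Cpos[of t] s t
      by (smt (verit) mult_pos_pos)
  qed (use t in auto)
  \<comment> \<open>The expansions at \<open>t\<close> and at \<open>t + s\<close> are compared at
    the common point \<open>t + s + r\<close>.\<close>
  have step: "B t + 2 * \<delta> * s \<le> B (t + s)" if t: "0 \<le> t" "0 \<le> s" "s < e t" for t s
  proof (rule eps)
    fix r assume r: "0 < r" "r \<le> e (t + s)" "r \<le> e t - s"
    have "\<psi> (t + (s + r)) = \<psi> ((t + s) + r)" by (simp add: algebra_simps)
    then have "(B t + 2 * C t * s + C t * r) * r = (B (t + s) + C (t + s) * r) * r"
      using \<psi>[of t s] \<psi>[of t "s + r"] \<psi>[of "t + s" r] r t
      by (simp add: algebra_simps power2_eq_square)
    then have "B t + 2 * C t * s + C t * r = B (t + s) + C (t + s) * r" using r by simp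
    moreover have "\<delta> * s \<le> C t * s" using C[of t] t by (simp add: mult_right_mono)
    moreover have "0 < C t * r" using Cpos[of t] r t by simp
    ultimately show "B t + 2 * \<delta> * s \<le> B (t + s) + C (t + s) * r" by linarith
  qed (use t in auto)
  have neg: "B t \<le> 0" if t: "0 \<le> t" for t
  proof -
    have "(B t + C t * e t) * e t \<le> 0" using \<psi>[of t "e t"] le[of t "t + e t"] e[OF t] t
      by (simp add: algebra_simps power2_eq_square)
    then have "B t + C t * e t \<le> 0" using e[OF t] by (simp add: mult_le_0_iff)
    then show ?thesis using mult_pos_pos[OF Cpos[OF t] e[OF t]] by linarith
  qed
  \<comment> \<open>\<open>S\<close> is bounded because \<open>B\<close> is nonpositive.
    Monotonicity of \<open>B\<close> puts the supremum into \<open>S\<close>, and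
    \<open>step\<close> then moves past it.\<close>
  define S where "S = {t. 0 \<le> t \<and> B 0 + 2 * \<delta> * t \<le> B t}"
  have "t \<le> - B 0 / (2 * \<delta>)" if "t \<in> S" for t
    using that neg[of t] \<open>0 < \<delta>\<close> by (simp add: S_def field_simps)
  then have bdd: "bdd_above S" by (meson bdd_above.I)
  have "0 \<in> S" by (simp add: S_def)
  define T where "T = Sup S"
  have T: "t \<le> T" if "t \<in> S" for t using that bdd by (simp add: T_def cSup_upper)
  have "0 \<le> T" using T[OF \<open>0 \<in> S\<close>] .
  have BT: "B 0 + 2 * \<delta> * T \<le> B T"
  proof (rule ccontr)
    assume "\<not> ?thesis"
    then have "(B T - B 0) / (2 * \<delta>) < T" using \<open>0 < \<delta>\<close> by (simp add: field_simps)
    then obtain t where "t \<in> S" "(B T - B 0) / (2 * \<delta>) < t"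
      using less_cSupD[of S] \<open>0 \<in> S\<close> unfolding T_def by blast
    then have "B T < B t" "t \<le> T" "0 \<le> t" using T \<open>0 < \<delta>\<close> by (auto simp: S_def field_simps)
    then show False using mono[of t T] by (cases "t = T") auto
  qed
  have "T + e T / 2 \<in> S"
    using BT step[of T "e T / 2"] e[OF \<open>0 \<le> T\<close>] \<open>0 \<le> T\<close> by (simp add: S_def algebra_simps)
  then show False using T e[OF \<open>0 \<le> T\<close>] by fastforce
qed

lemma convex_on_power2_nonneg:
  fixes \<phi> :: "'b::real_vector \<Rightarrow> real"
  assumes \<phi>: "convex_on A \<phi>" and nonneg: "\<And>x. x \<in> A \<Longrightarrow> 0 \<le> \<phi> x"
  shows "convex_on A (\<lambda>x. (\<phi> x)\<^sup>2)"
proof (rule convex_onI)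
  show cA: "convex A" using \<phi> convex_on_imp_convex by blast
  fix t x y assume t: "0 < t" "t < (1::real)" and xy: "x \<in> A" "y \<in> A"
  have "(1 - t) *\<^sub>R x + t *\<^sub>R y \<in> A" using cA xy t by (simp add: convex_alt)
  then have "(\<phi> ((1 - t) *\<^sub>R x + t *\<^sub>R y))\<^sup>2 \<le> ((1 - t) * \<phi> x + t * \<phi> y)\<^sup>2"
    using convex_onD[OF \<phi>, of t x y] t xy nonneg by (intro power_mono) auto
  also have "\<dots> \<le> (1 - t) * (\<phi> x)\<^sup>2 + t * (\<phi> y)\<^sup>2"
    using convex_onD[OF convex_power2, of t "\<phi> x" "\<phi> y"] t by simp
  finally show "(\<phi> ((1 - t) *\<^sub>R x + t *\<^sub>R y))\<^sup>2 \<le> (1 - t) * (\<phi> x)\<^sup>2 + t * (\<phi> y)\<^sup>2" .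
qed

section \<open>Weyl symmetries and vertex directions of the model flat\<close>

lemma subspace_model_flat: "subspace model_flat"
  unfolding subspace_def model_flat_def
proof (intro conjI ballI allI)
  fix x y :: "real^3" and c :: real
  assume x: "x \<in> {v. v $ 1 + v $ 2 + v $ 3 = 0}"
  show "x + y \<in> {v. v $ 1 + v $ 2 + v $ 3 = 0}" if "y \<in> {v. v $ 1 + v $ 2 + v $ 3 = 0}"
    using x that by (simp add: algebra_simps)
  have "c * (x $ 1 + x $ 2 + x $ 3) = 0" using x by simp
  then show "c *\<^sub>R x \<in> {v. v $ 1 + v $ 2 + v $ 3 = 0}" by (simp add: distrib_left)
qed simp

lemmas model_flat_simps [simp] =
  subspace_add[OF subspace_model_flat] subspace_diff[OF subspace_model_flat]
  subspace_neg[OF subspace_model_flat] subspace_mul[OF subspace_model_flat]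
  subspace_0[OF subspace_model_flat]

lemma Weyl_group_linear: "w \<in> Weyl_group \<Longrightarrow> linear w"
  by (auto simp: Weyl_group_def coord_perm_def vec_eq_iff intro!: linearI)

lemma finite_Weyl_group: "finite Weyl_group"
  unfolding Weyl_group_def by (rule finite_image_set) simp

lemma sum_coord_perm:
  assumes "bij \<sigma>" shows "(\<Sum>i\<in>UNIV. f (\<sigma> i)) = (\<Sum>i\<in>(UNIV::3 set). f i)"
  using assms by (rule sum.reindex_bij_betw)

lemma Weyl_group_inner: "w \<in> Weyl_group \<Longrightarrow> w u \<bullet> w v = u \<bullet> v"
  by (auto simp: Weyl_group_def coord_perm_def inner_vec_def sum_coord_perm[of _ "\<lambda>i. u $ i * v $ i"])

lemma Weyl_group_norm: "w \<in> Weyl_group \<Longrightarrow> norm (w u) = norm u"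
  by (simp add: norm_eq_sqrt_inner Weyl_group_inner)

lemma model_flat_iff_sum: "v \<in> model_flat \<longleftrightarrow> (\<Sum>i\<in>UNIV. v $ i) = 0"
  by (simp add: model_flat_def sum_3)

lemma Weyl_group_model_flat [simp]: "w \<in> Weyl_group \<Longrightarrow> w v \<in> model_flat \<longleftrightarrow> v \<in> model_flat"
  by (auto simp: Weyl_group_def coord_perm_def model_flat_iff_sum sum_coord_perm[of _ "\<lambda>i. v $ i"])

lemma coord_perm_coord_perm: "coord_perm \<sigma> (coord_perm \<tau> v) = coord_perm (\<tau> \<circ> \<sigma>) v"
  by (simp add: coord_perm_def)

lemma coord_perm_id: "coord_perm id v = v"
  by (simp add: coord_perm_def vec_eq_iff)

lemma Weyl_group_inverse:
  assumes "w \<in> Weyl_group"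
  obtains w' where "w' \<in> Weyl_group" "\<And>v. w' (w v) = v" "\<And>v. w (w' v) = v"
proof -
  obtain \<sigma> where \<sigma>: "w = coord_perm \<sigma>" "bij \<sigma>" using assms by (auto simp: Weyl_group_def)
  show ?thesis
    by (rule that[of "coord_perm (inv \<sigma>)"])
      (use \<sigma> in \<open>auto simp: Weyl_group_def coord_perm_coord_perm bij_imp_bij_inv bij_is_inj bij_is_surj coord_perm_id
          surj_iff[THEN iffD1] inj_iff[THEN iffD1]\<close>)
qed

text \<open>The factor makes these unit vectors. At mutual angles 2 pi / 3 and with sum 0, they are
  the directions of the points of the projective plane in a flat; their negatives are the directions
  of the lines.\<close>

definition vertex :: "3 \<Rightarrow> real^3" where
  "vertex i = sqrt (3/2) *\<^sub>R cls (axis i 1)"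

lemma cls_axis: "cls (axis i 1) $ j = (if i = j then 2/3 else -1/3)"
  using exhaust_3[of i] by (auto simp: cls_def axis_def)

lemma inner_cls_axis: "cls (axis i 1) \<bullet> cls (axis j 1) = (if i = j then 2/3 else -1/3)"
  using exhaust_3[of i] exhaust_3[of j] by (auto simp: inner_vec_def sum_3 cls_axis)

lemma inner_vertex: "vertex i \<bullet> vertex j = (if i = j then 1 else -1/2)"
proof -
  have "vertex i \<bullet> vertex j = (sqrt (3/2) * sqrt (3/2)) * (cls (axis i 1) \<bullet> cls (axis j 1))"
    unfolding vertex_def by (simp only: inner_scaleR_left inner_scaleR_right mult.assoc)
  then show ?thesis by (cases "i = j") (simp_all add: inner_cls_axis)
qed

lemma norm_vertex [simp]: "norm (vertex i) = 1"
  by (simp add: norm_eq_sqrt_inner inner_vertex)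

lemma vertex_inject [simp]: "vertex i = vertex j \<longleftrightarrow> i = j"
  using inner_vertex[of i j] inner_vertex[of i i] by (auto split: if_splits)

lemma vertex_model_flat [simp]: "vertex i \<in> model_flat"
  using exhaust_3[of i] by (auto simp: vertex_def model_flat_def cls_axis)

lemma sgn_cls_axis: "sgn (cls (axis i 1)) = vertex i"
  by (simp add: sgn_div_norm norm_eq_sqrt_inner inner_cls_axis vertex_def real_sqrt_divide)

lemma vertex_sum: assumes "i \<noteq> j" "j \<noteq> k" "i \<noteq> k" shows "vertex i + vertex j + vertex k = 0"
proof -
  have *: "vertex 1 + vertex 2 + vertex 3 = 0" by (simp add: vec_eq_iff forall_3 vertex_def cls_axis)
  then have "vertex i + vertex j + vertex k = vertex 1 + vertex 2 + vertex 3"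
    using exhaust_3[of i] exhaust_3[of j] exhaust_3[of k] assms by (elim disjE) (simp_all add: add_ac)
  then show ?thesis using * by simp
qed

lemma cls_line: "cls (axis 1 1 + axis 2 1) = - cls (axis 3 1)"
  by (simp add: vec_eq_iff cls_def axis_def forall_3)

lemma coord_perm_vertex: "bij \<sigma> \<Longrightarrow> coord_perm \<sigma> (vertex (\<sigma> i)) = vertex i"
  by (simp add: coord_perm_def vec_eq_iff vertex_def cls_axis bij_is_inj inj_eq)

lemma Weyl_group_vertex:
  assumes "w \<in> Weyl_group" obtains j where "w (vertex i) = vertex j"
proof -
  obtain \<sigma> where "bij \<sigma>" "w = coord_perm \<sigma>" using assms by (auto simp: Weyl_group_def)
  moreover obtain j where "i = \<sigma> j" using \<open>bij \<sigma>\<close> by (meson bij_pointE)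
  ultimately show ?thesis using that coord_perm_vertex by blast
qed

lemma Weyl_group_transitive:
  assumes "bij \<sigma>" obtains w where "w \<in> Weyl_group" "\<And>i. w (vertex (\<sigma> i)) = vertex i"
  using assms coord_perm_vertex unfolding Weyl_group_def by blast

section \<open>Flats and their ideal points\<close>

text \<open>The norms of \<open>a\<close>, \<open>b\<close> and \<open>b - a\<close> force the inner
  product \<open>t\<close>, which is the equality case of Cauchy-Schwarz.\<close>

lemma isometric_ray_affine:
  fixes \<rho> :: "real \<Rightarrow> 'b::real_inner"
  assumes \<rho>: "\<And>s t. 0 \<le> s \<Longrightarrow> 0 \<le> t \<Longrightarrow> dist (\<rho> s) (\<rho> t) = \<bar>s - t\<bar>" and "0 \<le> t"
  shows "\<rho> t = \<rho> 0 + t *\<^sub>R (\<rho> 1 - \<rho> 0)"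
proof -
  define a b where "a = \<rho> 1 - \<rho> 0" "b = \<rho> t - \<rho> 0"
  have "norm a = 1" "norm b = t" using \<rho>[of 1 0] \<rho>[of t 0] \<open>0 \<le> t\<close> by (auto simp: a_b_def dist_norm)
  moreover have "norm (b - a) = \<bar>t - 1\<bar>" using \<rho>[of t 1] \<open>0 \<le> t\<close> by (simp add: a_b_def dist_norm)
  ultimately have 1: "a \<bullet> a = 1" "b \<bullet> b = t\<^sup>2" "(b - a) \<bullet> (b - a) = (t - 1)\<^sup>2"
    by (simp_all flip: power2_norm_eq_inner)
  then have "a \<bullet> b = t" by (simp add: inner_simps inner_commute power2_eq_square algebra_simps)
  then have "(b - t *\<^sub>R a) \<bullet> (b - t *\<^sub>R a) = 0" using 1
    by (simp add: inner_simps inner_commute power2_eq_square algebra_simps)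
  then have "b = t *\<^sub>R a" by simp
  then show ?thesis by (simp add: a_b_def algebra_simps)
qed

locale A2_building =
  fixes \<F> :: "(real^3 \<Rightarrow> 'a::metric_space) set"
  assumes CAT0: "CAT0 TYPE('a)" and flat_axioms: "flat_axioms \<F>"
begin

section \<open>Marked flats as charts\<close>

lemma chart_dist:
  assumes "f \<in> \<F>" "a \<in> model_flat" "b \<in> model_flat"
  shows "dist (f a) (f b) = dist a b"
proof -
  have "\<forall>f\<in>\<F>. isometric_embedding f" using flat_axioms unfolding flat_axioms_def by (elim conjE)
  then have "isometric_embedding f" using assms(1) by (rule bspec)
  then show ?thesis using assms unfolding isometric_embedding_def by simp
qed

lemma chart_eq_iff: "f \<in> \<F> \<Longrightarrow> a \<in> model_flat \<Longrightarrow> b \<in> model_flat \<Longrightarrow> f a = f b \<longleftrightarrow> a = b"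
  using chart_dist by (metis dist_eq_0_iff)

lemma chart_change:
  assumes "f \<in> \<F>" "w \<in> Weyl_group" "b \<in> model_flat"
  obtains g where "g \<in> \<F>" "g ` model_flat = f ` model_flat" "\<And>v. v \<in> model_flat \<Longrightarrow> g v = f (w v + b)"
proof
  let ?g = "restrict (f \<circ> (\<lambda>v. w v + b)) model_flat"
  have "(\<lambda>v. w v + b) \<in> affine_Weyl_group" using assms unfolding affine_Weyl_group_def by blast
  moreover have "\<forall>f\<in>\<F>. \<forall>w\<in>affine_Weyl_group. restrict (f \<circ> w) model_flat \<in> \<F>"
    using flat_axioms unfolding flat_axioms_def by (elim conjE)
  ultimately show "?g \<in> \<F>" using assms(1) by blast
  show g: "?g v = f (w v + b)" if "v \<in> model_flat" for v using that by simp
  obtain w' where w': "w' \<in> Weyl_group" "\<And>v. w (w' v) = v" using Weyl_group_inverse assms by metis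
  have "f v \<in> ?g ` model_flat" if "v \<in> model_flat" for v
  proof (rule image_eqI)
    show 1: "w' (v - b) \<in> model_flat" using that w' assms by simp
    show "f v = ?g (w' (v - b))" unfolding g[OF 1] w' by simp
  qed
  moreover have "?g v \<in> f ` model_flat" if "v \<in> model_flat" for v
    unfolding g[OF that] using that assms by (intro imageI) simp
  ultimately show "?g ` model_flat = f ` model_flat" by blast
qed

lemma chart_transition:
  assumes "f \<in> \<F>" "g \<in> \<F>"
  obtains w b where "w \<in> Weyl_group" "b \<in> model_flat"
    "\<And>x y. x \<in> model_flat \<Longrightarrow> y \<in> model_flat \<Longrightarrow> f x = g y \<Longrightarrow> x = w y + b"
proof -
  have "\<forall>f\<in>\<F>. \<forall>f'\<in>\<F>. \<exists>w\<in>affine_Weyl_group.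
        \<forall>a\<in>model_flat. \<forall>b\<in>model_flat. f a = f' b \<longrightarrow> a = w b"
    using flat_axioms unfolding flat_axioms_def by (elim conjE)
  then obtain h where "h \<in> affine_Weyl_group"
    "\<And>x y. x \<in> model_flat \<Longrightarrow> y \<in> model_flat \<Longrightarrow> f x = g y \<Longrightarrow> x = h y"
    using assms by metis
  then show ?thesis using that unfolding affine_Weyl_group_def by blast
qed

lemma rays_common_flat:
  assumes "ray r" "ray r'"
  obtains h e where "h \<in> \<F>" "0 < e" "r ` {0..e} \<subseteq> h ` model_flat" "r' ` {0..e} \<subseteq> h ` model_flat"
proof -
  have "\<forall>r r'. ray r \<and> ray r' \<longrightarrow>
        (\<exists>f\<in>\<F>. \<exists>e>0. r ` {0..e} \<union> r' ` {0..e} \<subseteq> f ` model_flat)"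
    using flat_axioms unfolding flat_axioms_def by (elim conjE)
  then obtain h e where "h \<in> \<F>" "0 < e" "r ` {0..e} \<union> r' ` {0..e} \<subseteq> h ` model_flat"
    using assms by blast
  then show ?thesis using that by blast
qed

lemma chart_ray: "f \<in> \<F> \<Longrightarrow> a \<in> model_flat \<Longrightarrow> u \<in> model_flat \<Longrightarrow> norm u = 1 \<Longrightarrow> ray (\<lambda>t. f (a + t *\<^sub>R u))"
  by (auto simp: ray_def chart_dist dist_norm simp flip: scaleR_left_diff_distrib)

lemma chart_segment:
  assumes "f \<in> \<F>" "a \<in> model_flat" "b \<in> model_flat"
  shows "geodesic_segment (\<lambda>s. f (a + (s / dist a b) *\<^sub>R (b - a))) (f a) (f b)"
proof -
  have "dist (f (a + (s / dist a b) *\<^sub>R (b - a))) (f (a + (t / dist a b) *\<^sub>R (b - a))) = \<bar>s - t\<bar>"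
    if "s \<in> {0..dist a b}" "t \<in> {0..dist a b}" for s t
  proof (cases "a = b")
    case False
    have "dist (f (a + (s / dist a b) *\<^sub>R (b - a))) (f (a + (t / dist a b) *\<^sub>R (b - a)))
      = norm ((s / dist a b - t / dist a b) *\<^sub>R (b - a))"
      using assms by (simp add: chart_dist dist_norm flip: scaleR_left_diff_distrib)
    also have "\<dots> = \<bar>(s - t) / dist a b\<bar> * dist a b"
      by (simp add: diff_divide_distrib dist_norm norm_minus_commute)
    finally show ?thesis using False by (simp add: abs_divide)
  qed (use that in auto)
  then show ?thesis using assms by (cases "a = b") (auto simp: geodesic_segment_def chart_dist)
qed

lemma segment_eq:
  assumes "f \<in> \<F>" "g \<in> \<F>" "a \<in> model_flat" "b \<in> model_flat" "a' \<in> model_flat" "b' \<in> model_flat"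
    and "f a = g a'" "f b = g b'" "0 \<le> s" "s \<le> 1"
  shows "f (a + s *\<^sub>R (b - a)) = g (a' + s *\<^sub>R (b' - a'))"
proof (cases "a = b")
  case True
  then have "g a' = g b'" using assms by simp
  then have "a' = b'" using chart_eq_iff[of g] assms by simp
  then show ?thesis using True assms by simp
next
  case False
  have d: "dist a b = dist a' b'" using assms chart_dist by metis
  then have "a' \<noteq> b'" using False by auto
  show ?thesis
    using CAT0_geodesic_unique[OF CAT0 chart_segment[of f a b] chart_segment[of g a' b', folded assms(7,8)], of s]
      assms False d \<open>a' \<noteq> b'\<close> by (simp add: chart_dist)
qed

text \<open>The position of an ideal point on the circle at infinity of a marked flat. Starting the
  ray at 0 is harmless, parallel rays being asymptotic (\<open>heads_iff\<close>); every ideal point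
  of the flat has such a direction (\<open>boundary_iff_heads\<close>).\<close>

definition heads :: "(real^3 \<Rightarrow> 'a) \<Rightarrow> real^3 \<Rightarrow> 'a ideal_pt \<Rightarrow> bool" where
  "heads f u \<xi> \<longleftrightarrow> f \<in> \<F> \<and> u \<in> model_flat \<and> norm u = 1 \<and> \<xi> = ideal_point (\<lambda>t. f (t *\<^sub>R u))"

lemma headsD:
  assumes "heads f u \<xi>"
  shows "f \<in> \<F>" "u \<in> model_flat" "norm u = 1"
  using assms by (auto simp: heads_def)

lemma asymptotic_parallel:
  assumes "f \<in> \<F>" "a \<in> model_flat" "b \<in> model_flat" "u \<in> model_flat"
  shows "asymptotic (\<lambda>t. f (a + t *\<^sub>R u)) (\<lambda>t. f (b + t *\<^sub>R u))"
  unfolding asymptotic_def using assms by (intro exI[of _ "dist a b"]) (simp add: chart_dist)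

lemma heads_iff:
  assumes "f \<in> \<F>" "a \<in> model_flat" "u \<in> model_flat" "norm u = 1"
  shows "heads f u \<xi> \<longleftrightarrow> \<xi> = ideal_point (\<lambda>t. f (a + t *\<^sub>R u))"
proof -
  have "ideal_point (\<lambda>t. f (0 + t *\<^sub>R u)) = ideal_point (\<lambda>t. f (a + t *\<^sub>R u))"
    using assms chart_ray[of f 0 u] asymptotic_parallel[of f 0 a u] by (subst ideal_point_eq_iff) auto
  then show ?thesis using assms by (auto simp: heads_def)
qed

lemma heads_ideal_point:
  assumes "heads f u \<xi>" "a \<in> model_flat"
  shows "\<xi> = ideal_point (\<lambda>t. f (a + t *\<^sub>R u))" "ray (\<lambda>t. f (a + t *\<^sub>R u))"
  using heads_iff[OF headsD(1)[OF assms(1)] assms(2) headsD(2,3)[OF assms(1)]] assms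
    chart_ray[OF headsD(1)[OF assms(1)] assms(2) headsD(2,3)[OF assms(1)]] by simp_all

lemma heads_asymptotic:
  assumes "heads f u \<xi>" "heads g v \<xi>" "a \<in> model_flat" "b \<in> model_flat"
  shows "asymptotic (\<lambda>t. f (a + t *\<^sub>R u)) (\<lambda>t. g (b + t *\<^sub>R v))"
  using heads_ideal_point[OF assms(1,3)] heads_ideal_point[OF assms(2,4)] asymptotic_sym by (simp add: ideal_point_eq_iff)

lemma heads_ray_eq:
  assumes "heads f u \<xi>" "heads g v \<xi>" "a \<in> model_flat" "b \<in> model_flat" "f a = g b" "0 \<le> t"
  shows "f (a + t *\<^sub>R u) = g (b + t *\<^sub>R v)"
  using asymptotic_rays_eq[OF CAT0 heads_ideal_point(2)[OF assms(1,3)] heads_ideal_point(2)[OF assms(2,4)]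
    heads_asymptotic[OF assms(1-4)]] assms(5,6) by simp

text \<open>\<open>heads_ray_eq\<close> identifies only rays. A point inside the cone is the
  midpoint of the points at parameters \<open>2 * s\<close> and \<open>2 * t\<close> on the two
  bounding rays, so uniqueness of geodesics gives the rest.\<close>

lemma heads_cone_eq:
  assumes "heads f u \<xi>" "heads g v \<xi>" "heads f u' \<eta>" "heads g v' \<eta>"
    and "a \<in> model_flat" "b \<in> model_flat" "f a = g b" "0 \<le> s" "0 \<le> t"
  shows "f (a + s *\<^sub>R u + t *\<^sub>R u') = g (b + s *\<^sub>R v + t *\<^sub>R v')"
proof -
  note D = headsD[OF assms(1)] headsD[OF assms(2)] headsD[OF assms(3)] headsD[OF assms(4)]
  have 1: "f (a + (2 * s) *\<^sub>R u) = g (b + (2 * s) *\<^sub>R v)" "f (a + (2 * t) *\<^sub>R u') = g (b + (2 * t) *\<^sub>R v')"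
    using heads_ray_eq[OF assms(1,2,5-7)] heads_ray_eq[OF assms(3,4,5-7)] assms(8,9) by simp_all
  have "f ((a + (2 * s) *\<^sub>R u) + (1/2) *\<^sub>R ((a + (2 * t) *\<^sub>R u') - (a + (2 * s) *\<^sub>R u)))
    = g ((b + (2 * s) *\<^sub>R v) + (1/2) *\<^sub>R ((b + (2 * t) *\<^sub>R v') - (b + (2 * s) *\<^sub>R v)))"
    by (rule segment_eq[OF D(1,4) _ _ _ _ 1]) (simp_all add: assms(5,6) D)
  moreover have "(c + (2 * s) *\<^sub>R x) + (1/2) *\<^sub>R ((c + (2 * t) *\<^sub>R y) - (c + (2 * s) *\<^sub>R x)) = c + s *\<^sub>R x + t *\<^sub>R y"
    for c x y :: "real^3" by (simp add: vec_eq_iff algebra_simps)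
  ultimately show ?thesis by (simp only:)
qed

text \<open>The component along \<open>\<xi>\<close> can be recovered from distances:
  \<open>x + u\<close> and \<open>x' + v\<close> represent the same point of the building, so the
  squared distances from it and from \<open>x\<close> to the second common point agree in both
  charts. Two ideal points in independent directions thus determine a displacement.\<close>

lemma heads_inner_eq:
  assumes "heads f u \<xi>" "heads g v \<xi>" "x \<in> model_flat" "y \<in> model_flat" "x' \<in> model_flat" "y' \<in> model_flat"
    and "f x = g x'" "f y = g y'"
  shows "(x - y) \<bullet> u = (x' - y') \<bullet> v"
proof -
  note D = headsD[OF assms(1)] headsD[OF assms(2)]
  have "f (x + 1 *\<^sub>R u) = g (x' + 1 *\<^sub>R v)" by (rule heads_ray_eq[OF assms(1,2,3,5,7)]) simp
  then have "dist (x + u) y = dist (x' + v) y'" "dist x y = dist x' y'"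
    using assms D chart_dist[of f "x + u" y] chart_dist[of g "x' + v" y'] chart_dist[of f x y] chart_dist[of g x' y']
    by simp_all
  then have "norm ((x - y) + u) = norm ((x' - y') + v)" "norm (x - y) = norm (x' - y')"
    by (simp_all add: dist_norm algebra_simps)
  then have "((x - y) + u) \<bullet> ((x - y) + u) = ((x' - y') + v) \<bullet> ((x' - y') + v)"
    "(x - y) \<bullet> (x - y) = (x' - y') \<bullet> (x' - y')" "u \<bullet> u = v \<bullet> v"
    using norm_eq[of u v] D by (simp_all add: norm_eq)
  then show ?thesis by (simp add: inner_add inner_commute)
qed

text \<open>At time \<open>t\<close> the two rays of one chart are \<open>t\<close> times the chord
  apart, and passing to the other chart changes this by a bounded amount only. Exchanging the
  charts, the angle between two ideal points is the same in all flats containing both.\<close>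

lemma heads_dist_le:
  assumes "heads f u \<xi>" "heads f v \<eta>" "heads g u' \<xi>" "heads g v' \<eta>"
  shows "dist u v \<le> dist u' v'"
proof -
  note D = headsD[OF assms(1)] headsD[OF assms(2)] headsD[OF assms(3)] headsD[OF assms(4)]
  obtain K L where K: "\<And>t. 0 \<le> t \<Longrightarrow> dist (f (0 + t *\<^sub>R u)) (g (0 + t *\<^sub>R u')) \<le> K"
    and L: "\<And>t. 0 \<le> t \<Longrightarrow> dist (f (0 + t *\<^sub>R v)) (g (0 + t *\<^sub>R v')) \<le> L"
    using heads_asymptotic[OF assms(1,3), of 0 0] heads_asymptotic[OF assms(2,4), of 0 0]
    unfolding asymptotic_def by auto
  have "t * dist u v \<le> t * dist u' v' + (K + L)" if "0 \<le> t" for t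
  proof -
    have *: "dist (t *\<^sub>R u) (t *\<^sub>R v) \<le> dist (t *\<^sub>R u') (t *\<^sub>R v') + (K + L)"
      using K[OF that] L[OF that] D chart_dist[of f "t *\<^sub>R u" "t *\<^sub>R v"] chart_dist[of g "t *\<^sub>R u'" "t *\<^sub>R v'"]
        dist_triangle[of "f (t *\<^sub>R u)" "f (t *\<^sub>R v)" "g (t *\<^sub>R u')"]
        dist_triangle[of "g (t *\<^sub>R u')" "f (t *\<^sub>R v)" "g (t *\<^sub>R v')"]
      by (simp add: dist_commute)
    have "dist (t *\<^sub>R x) (t *\<^sub>R y) = t * dist x y" for x y :: "real^3"
      using that by (simp add: dist_norm flip: scaleR_right_diff_distrib)
    then show ?thesis using * by simp
  qed
  then have *: "t * (dist u v - dist u' v') \<le> K + L" if "0 \<le> t" for t using that by (simp add: algebra_simps)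
  show ?thesis
  proof (rule ccontr)
    assume "\<not> ?thesis"
    then have "0 < dist u v - dist u' v'" by simp
    then obtain n :: nat where "K + L < of_nat n * (dist u v - dist u' v')" using ex_less_of_nat_mult by blast
    then show False using *[of "of_nat n"] by simp
  qed
qed

lemma heads_dist_eq:
  assumes "heads f u \<xi>" "heads f v \<eta>" "heads g u' \<xi>" "heads g v' \<eta>"
  shows "dist u v = dist u' v'"
  using heads_dist_le assms by (meson antisym)

lemma ray_in_flat:
  assumes "f \<in> \<F>" "ray r" "r ` {0..} \<subseteq> f ` model_flat"
  obtains a u where "a \<in> model_flat" "heads f u (ideal_point r)" "\<And>t. 0 \<le> t \<Longrightarrow> r t = f (a + t *\<^sub>R u)"
proof -
  have "\<forall>t\<ge>0. \<exists>a\<in>model_flat. r t = f a" using assms(3) by (auto simp: image_subset_iff)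
  then obtain \<rho> where \<rho>: "\<And>t. 0 \<le> t \<Longrightarrow> \<rho> t \<in> model_flat" "\<And>t. 0 \<le> t \<Longrightarrow> r t = f (\<rho> t)" by metis
  have d: "dist (\<rho> s) (\<rho> t) = \<bar>s - t\<bar>" if "0 \<le> s" "0 \<le> t" for s t
    using that \<rho> assms(2) chart_dist[OF assms(1)] unfolding ray_def by metis
  define u where "u = \<rho> 1 - \<rho> 0"
  have u: "u \<in> model_flat" "norm u = 1" using \<rho> d[of 1 0] by (auto simp: u_def dist_norm)
  have r: "r t = f (\<rho> 0 + t *\<^sub>R u)" if "0 \<le> t" for t
    using isometric_ray_affine[of \<rho>, OF d that] \<rho>(2)[OF that] by (simp add: u_def)
  then have "asymptotic r (\<lambda>t. f (\<rho> 0 + t *\<^sub>R u))" by (auto simp: asymptotic_def)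
  then have "ideal_point r = ideal_point (\<lambda>t. f (\<rho> 0 + t *\<^sub>R u))" using assms(2) by (simp add: ideal_point_eq_iff)
  then have "heads f u (ideal_point r)" using heads_iff[OF assms(1)] \<rho>(1) u by blast
  then show ?thesis using that[of "\<rho> 0" u] \<rho>(1) r by simp
qed

lemma boundary_iff_heads:
  assumes "f \<in> \<F>" shows "\<xi> \<in> boundary (f ` model_flat) \<longleftrightarrow> (\<exists>u. heads f u \<xi>)"
proof
  assume "\<exists>u. heads f u \<xi>"
  then obtain u where u: "heads f u \<xi>" by blast
  then show "\<xi> \<in> boundary (f ` model_flat)"
    using headsD[OF u] heads_ideal_point[OF u, of 0] unfolding boundary_def
    by (auto intro!: exI[of _ "\<lambda>t. f (t *\<^sub>R u)"])
next
  assume "\<xi> \<in> boundary (f ` model_flat)"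
  then obtain r where r: "\<xi> = ideal_point r" "ray r" "r ` {0..} \<subseteq> f ` model_flat"
    unfolding boundary_def by blast
  obtain a u where "heads f u (ideal_point r)" by (rule ray_in_flat[OF assms r(2,3)])
  then show "\<exists>u. heads f u \<xi>" using r(1) by blast
qed

lemma heads_of_flat_ray:
  assumes \<xi>: "heads g v \<xi>" and f: "f \<in> \<F>" "a \<in> model_flat" "u \<in> model_flat" "flat_ray f a u \<in> \<xi>"
  shows "u \<noteq> 0" "heads f (sgn u) \<xi>"
proof -
  have r: "ray (flat_ray f a u)" and as: "asymptotic (\<lambda>t. g (t *\<^sub>R v)) (flat_ray f a u)"
    using f \<xi> by (auto simp: heads_def ideal_point_def)
  show "u \<noteq> 0"
  proof
    assume "u = 0"
    then have "dist (flat_ray f a u 0) (flat_ray f a u 1) = 0" by (simp add: flat_ray_def)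
    then show False using r unfolding ray_def by simp
  qed
  then have u: "sgn u \<in> model_flat" "norm (sgn u) = 1" using f by (simp_all add: sgn_div_norm)
  have "\<xi> = ideal_point (flat_ray f a u)"
    using as heads_ideal_point[OF \<xi>, of 0] by (simp add: ideal_point_eq_iff)
  then show "heads f (sgn u) \<xi>" using heads_iff[OF f(1,2) u] by (simp add: flat_ray_def)
qed

lemma flat_ray_of_heads:
  assumes "heads f u \<xi>" "a \<in> model_flat" shows "flat_ray f a u \<in> \<xi>"
proof -
  note D = headsD[OF assms(1)]
  show ?thesis using heads_ideal_point[OF assms] D
    by (auto simp: flat_ray_def ideal_point_def sgn_div_norm asymptotic_refl)
qed

lemma heads_chart_change:
  assumes "heads f (w u) \<xi>" "w \<in> Weyl_group" "b \<in> model_flat"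
    and g: "g \<in> \<F>" "\<And>v. v \<in> model_flat \<Longrightarrow> g v = f (w v + b)"
  shows "heads g u \<xi>"
proof -
  note D = headsD[OF assms(1)]
  have "\<xi> = ideal_point (\<lambda>t. f (b + t *\<^sub>R w u))" by (rule heads_ideal_point(1)[OF assms(1,3)])
  also have "(\<lambda>t. f (b + t *\<^sub>R w u)) = (\<lambda>t. g (t *\<^sub>R u))" using g D assms(2)
    by (auto simp: linear_scale[OF Weyl_group_linear] add.commute)
  finally show ?thesis using g D assms(2) by (simp add: heads_def Weyl_group_norm)
qed


text \<open>Otherwise, as the two rays are initially contained in a common flat at every time, the
  squared distance between them would be uniformly convex.\<close>

lemma heads_same_orbit:
  assumes f: "heads f u \<xi>" and g: "heads g v \<xi>"
  shows "\<exists>w\<in>Weyl_group. \<exists>w'\<in>Weyl_group. w u = w' v"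
proof (rule ccontr)
  assume neq: "\<not> ?thesis"
  note D = headsD[OF f] headsD[OF g]
  have lin: "linear w" if "w \<in> Weyl_group" for w using that by (rule Weyl_group_linear)
  have asym: "dist (f (t *\<^sub>R u)) (g (t *\<^sub>R v)) \<le> dist (f (s *\<^sub>R u)) (g (s *\<^sub>R v))" if "0 \<le> s" "s \<le> t" for s t
    using dist_asymptotic_le[OF CAT0 heads_ideal_point(2)[OF f, of "s *\<^sub>R u"]
        heads_ideal_point(2)[OF g, of "s *\<^sub>R v"] heads_asymptotic[OF f g], of "t - s"] that D
    by (simp flip: scaleR_left_distrib)
  define \<psi> where "\<psi> t = (dist (f (t *\<^sub>R u)) (g (t *\<^sub>R v)))\<^sup>2" for t
  \<comment> \<open>The possible squared relative speeds of the two rays in a common chart. They are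
    finitely many and nonzero by \<open>neq\<close>, so one lower bound serves all times although
    the chart varies with \<open>t\<close>.\<close>
  define X where "X = (\<lambda>(w, w'). (norm (w u - w' v))\<^sup>2) ` (Weyl_group \<times> Weyl_group)"
  have X: "finite X" by (simp add: X_def finite_Weyl_group)
  show False
  proof (rule no_bounded_uniformly_convex)
    show "convex_on {0..} \<psi>" unfolding \<psi>_def
      using convex_dist_rays[OF CAT0 heads_ideal_point(2)[OF f, of 0] heads_ideal_point(2)[OF g, of 0]]
      by (intro convex_on_power2_nonneg) simp_all
    show "\<psi> t \<le> \<psi> s" if "0 \<le> s" "s \<le> t" for s t
      unfolding \<psi>_def using asym[OF that] by (simp add: power_mono)
    show "0 < Min (insert 1 X)" using X neq by (auto simp: X_def)
    fix t :: real assume t: "0 \<le> t"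
    have "ray (\<lambda>s. f (t *\<^sub>R u + s *\<^sub>R u))" "ray (\<lambda>s. g (t *\<^sub>R v + s *\<^sub>R v))"
      using chart_ray D by simp_all
    then obtain h e where h: "h \<in> \<F>" "0 < e" "(\<lambda>s. f (t *\<^sub>R u + s *\<^sub>R u)) ` {0..e} \<subseteq> h ` model_flat"
      "(\<lambda>s. g (t *\<^sub>R v + s *\<^sub>R v)) ` {0..e} \<subseteq> h ` model_flat"
      by (rule rays_common_flat)
    obtain w b where w: "w \<in> Weyl_group" "b \<in> model_flat"
      "\<And>x y. x \<in> model_flat \<Longrightarrow> y \<in> model_flat \<Longrightarrow> h x = f y \<Longrightarrow> x = w y + b"
      using chart_transition[OF h(1) D(1)] by blast
    obtain w' b' where w': "w' \<in> Weyl_group" "b' \<in> model_flat"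
      "\<And>x y. x \<in> model_flat \<Longrightarrow> y \<in> model_flat \<Longrightarrow> h x = g y \<Longrightarrow> x = w' y + b'"
      using chart_transition[OF h(1) D(4)] by blast
    \<comment> \<open>In the chart \<open>h\<close> both rays are affine up to time
      \<open>e\<close>; \<open>d\<close> is their offset at time \<open>t\<close> and
      \<open>c\<close> their relative velocity.\<close>
    define d c where "d = (w (t *\<^sub>R u) + b) - (w' (t *\<^sub>R v) + b')" and "c = w u - w' v"
    have eq: "\<psi> (t + s) = d \<bullet> d + (2 * (d \<bullet> c)) * s + (c \<bullet> c) * s\<^sup>2" if s: "s \<in> {0..e}" for s
    proof -
      obtain x where x: "x \<in> model_flat" "h x = f (t *\<^sub>R u + s *\<^sub>R u)" using h(3) s by fastforce
      obtain y where y: "y \<in> model_flat" "h y = g (t *\<^sub>R v + s *\<^sub>R v)" using h(4) s by fastforce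
      have "x = w (t *\<^sub>R u + s *\<^sub>R u) + b" "y = w' (t *\<^sub>R v + s *\<^sub>R v) + b'"
        using w(3)[OF x(1) _ x(2)] w'(3)[OF y(1) _ y(2)] D by simp_all
      then have "x - y = d + s *\<^sub>R c"
        using linear_add[OF lin[OF w(1)]] linear_scale[OF lin[OF w(1)]]
          linear_add[OF lin[OF w'(1)]] linear_scale[OF lin[OF w'(1)]]
        by (simp add: d_def c_def algebra_simps)
      moreover have "\<psi> (t + s) = (dist (h x) (h y))\<^sup>2" by (simp add: \<psi>_def x(2) y(2) scaleR_left_distrib)
      then have "\<psi> (t + s) = (x - y) \<bullet> (x - y)"
        using chart_dist[OF h(1) x(1) y(1)] by (simp add: dist_norm power2_norm_eq_inner)
      ultimately show ?thesis by (simp add: inner_simps inner_commute algebra_simps power2_eq_square)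
    qed
    have "(norm c)\<^sup>2 \<in> X" unfolding X_def c_def using w(1) w'(1) by force
    then have "Min (insert 1 X) \<le> c \<bullet> c" using X by (simp add: power2_norm_eq_inner)
    moreover have "\<psi> t = d \<bullet> d" using eq[of 0] h(2) by simp
    ultimately show "\<exists>e>0. \<exists>B C. Min (insert 1 X) \<le> C \<and> (\<forall>s\<in>{0..e}. \<psi> (t + s) = \<psi> t + B * s + C * s\<^sup>2)"
      using eq h(2) by metis
  qed
qed

section \<open>Types of ideal points\<close>

lemma sgn_Weyl_group: "w \<in> Weyl_group \<Longrightarrow> sgn (w v) = w (sgn v)"
  by (simp add: sgn_div_norm Weyl_group_norm linear_scale[OF Weyl_group_linear])

lemma Weyl_group_2_transitive:
  assumes "i \<noteq> j" "i' \<noteq> j'"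
  obtains w where "w \<in> Weyl_group" "w (vertex i) = vertex i'" "w (vertex j) = vertex j'"
proof -
  define \<tau> where "\<tau> = Transposition.transpose i i'"
  \<comment> \<open>The second transposition corrects the value at \<open>j'\<close> and fixes
    \<open>i\<close>, as \<open>\<tau> j' \<noteq> i\<close>. In
    \<open>Weyl_group_transitive\<close> vertices move by the inverse permutation, so
    \<open>\<sigma>\<close> carries primed indices to unprimed ones.\<close>
  define \<sigma> where "\<sigma> = Transposition.transpose (\<tau> j') j \<circ> \<tau>"
  have "bij \<sigma>" by (simp add: \<sigma>_def \<tau>_def bij_comp)
  then obtain w where w: "w \<in> Weyl_group" "\<And>l. w (vertex (\<sigma> l)) = vertex l" using Weyl_group_transitive by blast
  have "\<sigma> i' = i" "\<sigma> j' = j" using assms by (auto simp: \<sigma>_def \<tau>_def Transposition.transpose_def)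
  then show ?thesis using that w by metis
qed

lemma ideal_points_of_type_iff:
  assumes "sgn (cls v) = u" "u \<in> model_flat" "u \<noteq> 0"
  shows "\<xi> \<in> ideal_points_of_type \<F> v \<longleftrightarrow> (\<exists>f. \<exists>w\<in>Weyl_group. heads f (w u) \<xi>)"
proof -
  have w: "w u \<in> model_flat" "norm (w u) = 1" "sgn (w (cls v)) = w u" if "w \<in> Weyl_group" for w
  proof -
    have "cls v \<noteq> 0" using assms by auto
    then have "norm u = 1" using assms(1) norm_sgn[of "cls v"] by simp
    then show "w u \<in> model_flat" "norm (w u) = 1" "sgn (w (cls v)) = w u"
      using that assms by (simp_all add: sgn_Weyl_group Weyl_group_norm)
  qed
  show ?thesis
  proof
    assume "\<xi> \<in> ideal_points_of_type \<F> v"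
    then obtain f a w where *: "\<xi> = ideal_point (flat_ray f a (w (cls v)))" "f \<in> \<F>" "a \<in> model_flat" "w \<in> Weyl_group"
      unfolding ideal_points_of_type_def by blast
    then have "heads f (w u) \<xi>" using heads_iff[OF *(2,3) w(1,2)[OF *(4)]] by (simp add: flat_ray_def w(3))
    then show "\<exists>f. \<exists>w\<in>Weyl_group. heads f (w u) \<xi>" using *(4) by blast
  next
    assume "\<exists>f. \<exists>w\<in>Weyl_group. heads f (w u) \<xi>"
    then obtain f w where *: "w \<in> Weyl_group" "heads f (w u) \<xi>" by blast
    then have "\<xi> = ideal_point (flat_ray f 0 (w (cls v)))"
      using heads_ideal_point(1)[OF *(2), of 0] by (simp add: flat_ray_def w(3))
    then show "\<xi> \<in> ideal_points_of_type \<F> v"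
      using *(1) headsD(1)[OF *(2)] model_flat_simps(5) unfolding ideal_points_of_type_def by blast
  qed
qed

lemma vertex_nonzero [simp]: "vertex i \<noteq> 0"
  using norm_vertex[of i] by force

lemma Weyl_group_vertex_transitive:
  obtains w where "w \<in> Weyl_group" "w (vertex i) = vertex j"
proof -
  have "i \<noteq> i + 1" "j \<noteq> j + 1" by simp_all
  then show ?thesis using Weyl_group_2_transitive that by metis
qed

lemma proj_points_iff: "\<xi> \<in> proj_points \<F> \<longleftrightarrow> (\<exists>f i. heads f (vertex i) \<xi>)"
  using ideal_points_of_type_iff[OF sgn_cls_axis[of 1]] Weyl_group_vertex[of _ 1] Weyl_group_vertex_transitive[of 1]
  unfolding proj_points_def by (metis vertex_model_flat vertex_nonzero)

lemma proj_lines_iff: "\<xi> \<in> proj_lines \<F> \<longleftrightarrow> (\<exists>f i. heads f (- vertex i) \<xi>)"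
proof -
  have "sgn (cls (axis 1 1 + axis 2 1)) = - vertex 3" by (simp add: cls_line sgn_minus sgn_cls_axis)
  moreover have "w (- vertex 3) = - w (vertex 3)" if "w \<in> Weyl_group" for w
    using that by (simp add: linear_neg[OF Weyl_group_linear])
  ultimately have "\<xi> \<in> proj_lines \<F> \<longleftrightarrow> (\<exists>f. \<exists>w\<in>Weyl_group. heads f (- w (vertex 3)) \<xi>)"
    using ideal_points_of_type_iff[of "axis 1 1 + axis 2 1" "- vertex 3" \<xi>]
    unfolding proj_lines_def by auto
  then show ?thesis using Weyl_group_vertex[of _ 3] Weyl_group_vertex_transitive[of 3] by metis
qed

text \<open>Membership in \<open>proj_points\<close> gives a vertex direction in some chart only;
  \<open>heads_same_orbit\<close> transfers it to every chart with this point at infinity.\<close>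

lemma heads_proj_point:
  assumes "heads f u \<xi>" "\<xi> \<in> proj_points \<F>"
  obtains i where "u = vertex i"
proof -
  obtain g j where "heads g (vertex j) \<xi>" using assms(2) proj_points_iff by blast
  then obtain w w' where w: "w \<in> Weyl_group" "w' \<in> Weyl_group" "w u = w' (vertex j)"
    using heads_same_orbit assms(1) by blast
  obtain v where v: "v \<in> Weyl_group" "v (w u) = u" using Weyl_group_inverse[OF w(1)] by metis
  then show ?thesis using that Weyl_group_vertex w(2,3) by metis
qed

lemma heads_proj_line:
  assumes "heads f u \<xi>" "\<xi> \<in> proj_lines \<F>"
  obtains i where "u = - vertex i"
proof -
  obtain g j where "heads g (- vertex j) \<xi>" using assms(2) proj_lines_iff by blast
  then obtain w w' where w: "w \<in> Weyl_group" "w' \<in> Weyl_group" "w u = w' (- vertex j)"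
    using heads_same_orbit assms(1) by blast
  obtain v where v: "v \<in> Weyl_group" "v (w u) = u" using Weyl_group_inverse[OF w(1)] by metis
  obtain k where k: "w' (vertex j) = vertex k" using Weyl_group_vertex[OF w(2)] .
  obtain l where l: "v (vertex k) = vertex l" using Weyl_group_vertex[OF v(1)] .
  have "u = - vertex l" using v w k l by (simp add: linear_neg[OF Weyl_group_linear])
  then show ?thesis by (rule that)
qed

end

section \<open>The projective plane at infinity\<close>

lemma obtain_third:
  fixes i j :: 3
  obtains k where "k \<noteq> i" "k \<noteq> j"
proof -
  have "\<not> (\<forall>k. k = i \<or> k = j)"
  proof
    assume *: "\<forall>k. k = i \<or> k = j"
    show False using *[rule_format, of 1] *[rule_format, of 2] *[rule_format, of 3] by (elim disjE) auto
  qed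
  then show ?thesis using that by blast
qed

lemma third_cases:
  fixes i j k :: 3
  assumes "i \<noteq> j" "j \<noteq> k" "i \<noteq> k"
  shows "m = i \<or> m = j \<or> m = k"
  using exhaust_3[of i] exhaust_3[of j] exhaust_3[of k] exhaust_3[of m] assms by (elim disjE) simp_all

lemma vertex_decompose:
  assumes "z \<in> model_flat" "i \<noteq> j"
  obtains s t where "z = s *\<^sub>R vertex i + t *\<^sub>R vertex j"
proof -
  obtain k where k: "k \<noteq> i" "k \<noteq> j" by (rule obtain_third)
  define r where "r = sqrt (3/2)"
  have r: "r * (2/3) \<noteq> 0" by (simp add: r_def)
  have v: "vertex l $ m = (if l = m then r * (2/3) else - r / 3)" for l m by (simp add: vertex_def cls_axis r_def)
  have univ: "m = i \<or> m = j \<or> m = k" for m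
    using third_cases[of i j k m] assms k by auto
  have sum: "z $ i + z $ j + z $ k = 0"
    using assms k exhaust_3[of i] exhaust_3[of j] exhaust_3[of k] by (elim disjE) (simp_all add: model_flat_def)
  define s t where "s = (z $ i - z $ k) / r" and "t = (z $ j - z $ k) / r"
  have st: "s * r = z $ i - z $ k" "t * r = z $ j - z $ k" using r by (simp_all add: s_def t_def)
  have "z $ m = (s *\<^sub>R vertex i + t *\<^sub>R vertex j) $ m" for m
    using univ[of m] assms k st sum by (auto simp: v algebra_simps)
  then have "z = s *\<^sub>R vertex i + t *\<^sub>R vertex j" unfolding vec_eq_iff by blast
  then show ?thesis by (rule that)
qed

lemma vertex_independent:
  assumes "s *\<^sub>R vertex i + t *\<^sub>R vertex j = s' *\<^sub>R vertex i + t' *\<^sub>R vertex j" "i \<noteq> j"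
  shows "s = s'" "t = t'"
proof -
  have "(s *\<^sub>R vertex i + t *\<^sub>R vertex j) \<bullet> vertex l = (s' *\<^sub>R vertex i + t' *\<^sub>R vertex j) \<bullet> vertex l" for l
    using assms by simp
  from this[of i] this[of j] show "s = s'" "t = t'" using assms(2) by (auto simp: inner_simps inner_vertex)
qed

lemma model_flat_eqI:
  assumes "x \<in> model_flat" "y \<in> model_flat" "i \<noteq> j" "x \<bullet> vertex i = y \<bullet> vertex i" "x \<bullet> vertex j = y \<bullet> vertex j"
  shows "x = y"
proof -
  obtain s t where x: "x - y = s *\<^sub>R vertex i + t *\<^sub>R vertex j" using vertex_decompose assms by (metis model_flat_simps(2))
  have "(x - y) \<bullet> vertex i = 0" "(x - y) \<bullet> vertex j = 0" using assms by (simp_all add: inner_diff_left)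
  then have "s = 0" "t = 0" using \<open>i \<noteq> j\<close> unfolding x by (auto simp: inner_simps inner_vertex)
  then show ?thesis using x by simp
qed

text \<open>As the three vertices sum to 0, the coefficients of \<open>z\<close> on them are defined
  up to a common constant; subtracting the smallest leaves two nonnegative ones.\<close>

lemma three_sectors:
  assumes "z \<in> model_flat" "i \<noteq> j" "j \<noteq> k" "i \<noteq> k"
  obtains s t where "0 \<le> s" "0 \<le> t" "z = s *\<^sub>R vertex i + t *\<^sub>R vertex j"
    | s t where "0 \<le> s" "0 \<le> t" "z = s *\<^sub>R vertex i + t *\<^sub>R vertex k"
    | s t where "0 \<le> s" "0 \<le> t" "z = s *\<^sub>R vertex j + t *\<^sub>R vertex k"
proof -
  obtain s t where z: "z = s *\<^sub>R vertex i + t *\<^sub>R vertex j" using vertex_decompose assms by metis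
  have k: "vertex k = - vertex i - vertex j" using vertex_sum[OF assms(2-4)] by (simp add: algebra_simps eq_neg_iff_add_eq_0)
  have "z = (s - t) *\<^sub>R vertex i + (- t) *\<^sub>R vertex k" "z = (t - s) *\<^sub>R vertex j + (- s) *\<^sub>R vertex k"
    by (simp_all add: z k algebra_simps)
  then show ?thesis using that(1)[of s t] that(2)[of "s - t" "- t"] that(3)[of "t - s" "- s"] z by linarith
qed

text \<open>A point and a line of one apartment are opposite (distance 2) or adjacent (angle pi / 3,
  distance 1), so the distance tells which.\<close>

lemma dist_minus_vertex: "dist (vertex i) (- vertex j) = dist (vertex i') (- vertex j') \<Longrightarrow> i = j \<longleftrightarrow> i' = j'"
proof -
  have "(dist (vertex i) (- vertex j))\<^sup>2 = (if i = j then 4 else 1)" for i j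
    by (simp add: dist_norm power2_norm_eq_inner inner_simps inner_vertex inner_commute)
  then show "dist (vertex i) (- vertex j) = dist (vertex i') (- vertex j') \<Longrightarrow> i = j \<longleftrightarrow> i' = j'"
    by (smt (verit))
qed

text \<open>A ray inside the open chamber may run parallel to a wall, hence only weak
  inequalities.\<close>

lemma model_chamber_ray_direction:
  assumes "\<And>t. 0 \<le> t \<Longrightarrow> a + t *\<^sub>R u \<in> model_chamber"
  shows "u $ 1 \<ge> u $ 2" "u $ 2 \<ge> u $ 3"
proof -
  have "u $ j \<le> u $ i" if gt: "\<And>t. 0 \<le> t \<Longrightarrow> a $ i + t * u $ i > a $ j + t * u $ j" for i j
  proof (rule ccontr)
    assume "\<not> ?thesis"
    then have "0 < u $ j - u $ i" by simp
    then obtain n :: nat where "a $ i - a $ j < of_nat n * (u $ j - u $ i)" using ex_less_of_nat_mult by blast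
    then show False using gt[of "of_nat n"] by (simp add: algebra_simps)
  qed
  then show "u $ 1 \<ge> u $ 2" "u $ 2 \<ge> u $ 3" using assms by (auto simp: model_chamber_def)
qed

context A2_building begin

section \<open>Incidence and lines read in charts\<close>

lemma heads_in_chamber:
  assumes g: "g \<in> \<F>" and \<xi>: "\<xi> \<in> boundary (g ` model_chamber)"
  obtains u where "heads g u \<xi>" "u $ 1 \<ge> u $ 2" "u $ 2 \<ge> u $ 3"
proof -
  obtain r where r: "\<xi> = ideal_point r" "ray r" "r ` {0..} \<subseteq> g ` model_chamber"
    using \<xi> unfolding boundary_def by blast
  have c: "model_chamber \<subseteq> model_flat" by (auto simp: model_chamber_def)
  then have "r ` {0..} \<subseteq> g ` model_flat" using r(3) by blast
  then obtain a u where u: "a \<in> model_flat" "heads g u (ideal_point r)" "\<And>t. 0 \<le> t \<Longrightarrow> r t = g (a + t *\<^sub>R u)"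
    using ray_in_flat[OF g r(2)] by metis
  have "a + t *\<^sub>R u \<in> model_chamber" if "0 \<le> t" for t
  proof -
    obtain x where x: "x \<in> model_chamber" "r t = g x" using r(3) \<open>0 \<le> t\<close> by fastforce
    then have "a + t *\<^sub>R u = x" using u(1,3) that c chart_eq_iff[OF g, of "a + t *\<^sub>R u" x] headsD(2)[OF u(2)] by auto
    then show ?thesis using x by simp
  qed
  then show ?thesis using that model_chamber_ray_direction u(2) r(1) by blast
qed

lemma incident_heads:
  assumes "incident \<F> p D"
  obtains g where "heads g (vertex 1) p" "heads g (- vertex 3) D"
proof -
  obtain g where g: "g \<in> \<F>" "p \<in> boundary (g ` model_chamber)" "D \<in> boundary (g ` model_chamber)"
    using assms unfolding incident_def ideal_chambers_def Weyl_chambers_def by blast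
  obtain u where u: "heads g u p" "u $ 1 \<ge> u $ 2" "u $ 2 \<ge> u $ 3" using heads_in_chamber[OF g(1,2)] .
  obtain v where v: "heads g v D" "v $ 1 \<ge> v $ 2" "v $ 2 \<ge> v $ 3" using heads_in_chamber[OF g(1,3)] .
  obtain i where i: "u = vertex i" using heads_proj_point[OF u(1)] assms unfolding incident_def by blast
  obtain j where j: "v = - vertex j" using heads_proj_line[OF v(1)] assms unfolding incident_def by blast
  have "i = 1" using u exhaust_3[of i] by (auto simp: i vertex_def cls_axis)
  moreover have "j = 3" using v exhaust_3[of j] by (auto simp: j vertex_def cls_axis)
  ultimately show ?thesis using that u(1) v(1) i j by blast
qed

text \<open>The two vertices of an ideal chamber make an angle pi / 3 in its own chart, and angles
  at infinity do not depend on the chart; so incident vertices are never opposite. Conversely, a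
  Weyl group element turns adjacent directions into the edges of the model chamber.\<close>

lemma incident_iff:
  assumes "heads f (vertex i) p" "heads f (- vertex j) D"
  shows "incident \<F> p D \<longleftrightarrow> i \<noteq> j"
proof
  assume "incident \<F> p D"
  then obtain g where "heads g (vertex 1) p" "heads g (- vertex 3) D" by (rule incident_heads)
  then have "dist (vertex i) (- vertex j) = dist (vertex 1) (- vertex 3)"
    using heads_dist_eq assms by blast
  from dist_minus_vertex[OF this] show "i \<noteq> j" by simp
next
  assume "i \<noteq> j"
  obtain w where w: "w \<in> Weyl_group" "w (vertex 1) = vertex i" "w (vertex 3) = vertex j"
    by (rule Weyl_group_2_transitive[of 1 3 i j]) (use \<open>i \<noteq> j\<close> in simp_all)
  obtain g where g: "g \<in> \<F>" "\<And>v. v \<in> model_flat \<Longrightarrow> g v = f (w v + 0)"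
    using chart_change[OF headsD(1)[OF assms(1)] w(1) model_flat_simps(5)] by metis
  have "w (- vertex 3) = - vertex j" using w by (simp add: linear_neg[OF Weyl_group_linear])
  then have h: "heads g (vertex 1) p" "heads g (- vertex 3) D"
    using heads_chart_change[OF _ w(1) model_flat_simps(5) g] assms w(2) by simp_all
  \<comment> \<open>A point of the open chamber, so that rays from it parallel to the walls stay in
    the open chamber.\<close>
  define a where "a = vertex 1 - vertex 3"
  have a: "a \<in> model_flat" by (simp add: a_def)
  have mem: "\<xi> \<in> boundary (g ` model_chamber)"
    if "heads g u \<xi>" "\<And>t. 0 \<le> t \<Longrightarrow> a + t *\<^sub>R u \<in> model_chamber" for u \<xi>
    using heads_ideal_point[OF that(1) a] that(2) unfolding boundary_def by blast
  define r where "r = sqrt (3/2)"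
  have v: "vertex l $ m = (if l = m then r * (2/3) else - r / 3)" for l m by (simp add: vertex_def cls_axis r_def)
  have "a + t *\<^sub>R vertex 1 \<in> model_chamber" "a + t *\<^sub>R (- vertex 3) \<in> model_chamber" if "0 \<le> t" for t
  proof -
    have "0 < r" "0 \<le> r * t" using that by (simp_all add: r_def)
    then show "a + t *\<^sub>R vertex 1 \<in> model_chamber" "a + t *\<^sub>R (- vertex 3) \<in> model_chamber"
      using a by (simp_all add: model_chamber_def) (simp_all add: a_def v algebra_simps)
  qed
  then have "p \<in> boundary (g ` model_chamber)" "D \<in> boundary (g ` model_chamber)" using mem h by blast+
  moreover have "p \<in> proj_points \<F>" "D \<in> proj_lines \<F>" using assms proj_points_iff proj_lines_iff by blast+
  ultimately show "incident \<F> p D"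
    using g(1) unfolding incident_def ideal_chambers_def Weyl_chambers_def by blast
qed

text \<open>All permutations of the vertex directions and all translations are available, so the
  labels of the points and the origin can be prescribed. Matching two labels is enough, each vertex
  being minus the sum of the other two.\<close>

lemma three_points_chart:
  assumes A: "flat_through \<F> {\<xi>\<^sub>i, \<xi>\<^sub>j, \<xi>\<^sub>k} A" and y: "y \<in> A" and points: "{\<xi>\<^sub>i, \<xi>\<^sub>j, \<xi>\<^sub>k} \<subseteq> proj_points \<F>"
    and neq: "\<xi>\<^sub>i \<noteq> \<xi>\<^sub>j" "\<xi>\<^sub>j \<noteq> \<xi>\<^sub>k" "\<xi>\<^sub>i \<noteq> \<xi>\<^sub>k" and ijk: "i \<noteq> j" "j \<noteq> k" "i \<noteq> k"
  obtains f where "f ` model_flat = A" "f 0 = y"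
    "heads f (vertex i) \<xi>\<^sub>i" "heads f (vertex j) \<xi>\<^sub>j" "heads f (vertex k) \<xi>\<^sub>k"
proof -
  obtain f where f: "f \<in> \<F>" "A = f ` model_flat" using A unfolding flat_through_def flats_def by blast
  have \<xi>: "{\<xi>\<^sub>i, \<xi>\<^sub>j, \<xi>\<^sub>k} \<subseteq> boundary A" using A by (simp add: flat_through_def)
  from f(2) obtain x where x: "x \<in> model_flat" "y = f x" using y by blast
  have ex: "\<exists>i. heads f (vertex i) \<xi>" if \<xi>: "\<xi> \<in> boundary A" "\<xi> \<in> proj_points \<F>" for \<xi>
  proof -
    obtain u where "heads f u \<xi>" using \<xi>(1) boundary_iff_heads[OF f(1), of \<xi>] f(2) by auto
    then show ?thesis using heads_proj_point \<xi>(2) by metis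
  qed
  obtain i' where i': "heads f (vertex i') \<xi>\<^sub>i" using ex[of \<xi>\<^sub>i] \<xi> points by auto
  obtain j' where j': "heads f (vertex j') \<xi>\<^sub>j" using ex[of \<xi>\<^sub>j] \<xi> points by auto
  obtain k' where k': "heads f (vertex k') \<xi>\<^sub>k" using ex[of \<xi>\<^sub>k] \<xi> points by auto
  note h = i' j' k'
  have ne: "i' \<noteq> j'" "j' \<noteq> k'" "i' \<noteq> k'" using h neq unfolding heads_def by metis+
  obtain w where w: "w \<in> Weyl_group" "w (vertex i) = vertex i'" "w (vertex j) = vertex j'"
    using Weyl_group_2_transitive[OF ijk(1) ne(1)] by blast
  have k: "vertex k = - vertex i - vertex j" "vertex k' = - vertex i' - vertex j'"
    using vertex_sum[OF ijk] vertex_sum[OF ne] by (simp_all add: algebra_simps eq_neg_iff_add_eq_0)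
  have w3: "w (vertex k) = vertex k'" unfolding k
    using w by (simp add: linear_diff[OF Weyl_group_linear] linear_neg[OF Weyl_group_linear])
  obtain g where g: "g \<in> \<F>" "g ` model_flat = f ` model_flat" "\<And>v. v \<in> model_flat \<Longrightarrow> g v = f (w v + x)"
    using chart_change[OF f(1) w(1) x(1)] by blast
  note change = heads_chart_change[OF _ w(1) x(1) g(1) g(3)]
  show ?thesis
  proof (rule that[of g])
    show "g 0 = y" using g(3)[of 0] x by (simp add: linear_0[OF Weyl_group_linear[OF w(1)]])
    show "heads g (vertex i) \<xi>\<^sub>i" "heads g (vertex j) \<xi>\<^sub>j" "heads g (vertex k) \<xi>\<^sub>k"
      using change[of "vertex i"] change[of "vertex j"] change[of "vertex k"] by (simp_all add: w w3 h)
  qed (use g f in simp)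
qed


text \<open>The ray to a line incident to \<open>a\<close> and \<open>b\<close> almost passes through the midpoints of the
  segments joining the rays to \<open>a\<close> and \<open>b\<close>.\<close>

lemma line_through_points_unique:
  assumes g: "heads g (vertex i) a" "heads g (vertex j) b" "heads g (- vertex k) L"
    and ijk: "i \<noteq> j" "j \<noteq> k" "i \<noteq> k"
    and inc: "incident \<F> a D" "incident \<F> b D"
  shows "D = L"
proof -
  note D = headsD[OF g(1)]
  obtain h where h: "heads h (vertex 1) a" "heads h (- vertex 3) D" using incident_heads[OF inc(1)] .
  obtain h' where h': "heads h' (vertex 1) b" "heads h' (- vertex 3) D" using incident_heads[OF inc(2)] .
  define l d where "l t = g (0 + t *\<^sub>R (- vertex k))" and "d t = h (0 + t *\<^sub>R (- vertex 3))" for t :: real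
  have rays: "ray l" "ray d" unfolding l_def d_def
    by (rule heads_ideal_point(2)[OF g(3) model_flat_simps(5)] heads_ideal_point(2)[OF h(2) model_flat_simps(5)])+
  \<comment> \<open>Sides \<open>t\<close> and \<open>2 * t\<close> enclosing the angle pi / 3. The
    factor 2 is chosen because the midpoint of the points at time \<open>2 * t\<close> towards
    \<open>a\<close> and \<open>b\<close> is the point at time \<open>t\<close> towards
    \<open>L\<close>.\<close>
  have e: "dist (t *\<^sub>R (- vertex 3)) ((2 * t) *\<^sub>R vertex 1) = sqrt 3 * t" if "0 \<le> t" for t :: real
  proof -
    have "(dist (t *\<^sub>R (- vertex 3)) ((2 * t) *\<^sub>R vertex 1))\<^sup>2 = 3 * t\<^sup>2"
      unfolding dist_norm power2_norm_eq_inner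
      by (simp add: inner_simps inner_vertex inner_commute power2_eq_square algebra_simps)
    then have "dist (t *\<^sub>R (- vertex 3)) ((2 * t) *\<^sub>R vertex 1) = sqrt (3 * t\<^sup>2)"
      by (metis real_sqrt_abs abs_of_nonneg zero_le_dist)
    then show ?thesis using that by (simp add: real_sqrt_mult)
  qed
  have near: "\<exists>K. \<forall>t\<ge>0. dist (d t) (g ((2 * t) *\<^sub>R vertex m)) \<le> sqrt 3 * t + K"
    if f: "heads f (vertex 1) c" "heads f (- vertex 3) D" and m: "heads g (vertex m) c" for f c m
  proof -
    obtain K where K: "\<And>t. 0 \<le> t \<Longrightarrow> dist (f (0 + t *\<^sub>R vertex 1)) (g (0 + t *\<^sub>R vertex m)) \<le> K"
      using heads_asymptotic[OF f(1) m, of 0 0] unfolding asymptotic_def by auto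
    obtain K' where K': "\<And>t. 0 \<le> t \<Longrightarrow> dist (d t) (f (0 + t *\<^sub>R (- vertex 3))) \<le> K'"
      using heads_asymptotic[OF h(2) f(2), of 0 0] unfolding asymptotic_def d_def by auto
    have "dist (d t) (g ((2 * t) *\<^sub>R vertex m)) \<le> sqrt 3 * t + (K + K')" if t: "0 \<le> t" for t
    proof -
      have "dist (f (t *\<^sub>R (- vertex 3))) (f ((2 * t) *\<^sub>R vertex 1)) = sqrt 3 * t"
        using chart_dist[OF headsD(1)[OF f(1)], of "t *\<^sub>R (- vertex 3)" "(2 * t) *\<^sub>R vertex 1"] e[OF t] by simp
      then show ?thesis using K[of "2 * t"] K'[OF t] t
        dist_triangle[of "d t" "g ((2 * t) *\<^sub>R vertex m)" "f ((2 * t) *\<^sub>R vertex 1)"]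
        dist_triangle[of "d t" "f ((2 * t) *\<^sub>R vertex 1)" "f (t *\<^sub>R (- vertex 3))"] by simp
    qed
    then show ?thesis by blast
  qed
  obtain K where K: "\<And>t. 0 \<le> t \<Longrightarrow> dist (d t) (g ((2 * t) *\<^sub>R vertex i)) \<le> sqrt 3 * t + K"
    using near[OF h g(1)] by blast
  obtain K' where K': "\<And>t. 0 \<le> t \<Longrightarrow> dist (d t) (g ((2 * t) *\<^sub>R vertex j)) \<le> sqrt 3 * t + K'"
    using near[OF h' g(2)] by blast
  define C where "C = max 0 (max K K')"
  have C: "0 \<le> C" "K \<le> C" "K' \<le> C" by (auto simp: C_def)
  \<comment> \<open>The quadratic terms cancel in the Bruhat-Tits inequality:
    \<open>3 * t\<^sup>2\<close> against a quarter of \<open>12 * t\<^sup>2\<close>. What remains is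
    linear, so the distance grows at most like a square root, and convexity then makes it
    bounded.\<close>
  have bound: "(dist (l t) (d t))\<^sup>2 \<le> 4 * C * t + C\<^sup>2" if t: "0 \<le> t" for t
  proof -
    let ?x = "(2 * t) *\<^sub>R vertex i" and ?y = "(2 * t) *\<^sub>R vertex j"
    have mid: "?x + (1/2) *\<^sub>R (?y - ?x) = t *\<^sub>R (- vertex k)"
    proof -
      have *: "- vertex k = vertex i + vertex j"
        using minus_unique[of "vertex k" "vertex i + vertex j"] vertex_sum[OF ijk] by (simp add: add.commute)
      show ?thesis unfolding * by (simp add: vec_eq_iff algebra_simps)
    qed
    have "(dist ?x ?y)\<^sup>2 = 12 * t\<^sup>2"
      unfolding dist_norm power2_norm_eq_inner
      using ijk by (simp add: inner_simps inner_vertex inner_commute power2_eq_square algebra_simps)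
    moreover have "dist (g ?x) (g ?y) = dist ?x ?y" using chart_dist[OF D(1)] by simp
    ultimately have xy: "(dist (g ?x) (g ?y))\<^sup>2 = 12 * t\<^sup>2" by simp
    have gm: "g (?x + ((dist (g ?x) (g ?y) / 2) / dist ?x ?y) *\<^sub>R (?y - ?x)) = l t"
    proof -
      have "?x + ((dist (g ?x) (g ?y) / 2) / dist ?x ?y) *\<^sub>R (?y - ?x) = ?x + (1/2) *\<^sub>R (?y - ?x)"
        unfolding \<open>dist (g ?x) (g ?y) = dist ?x ?y\<close> by simp
      then show ?thesis unfolding mid l_def by simp
    qed
    have sq: "(dist (g z) (d t))\<^sup>2 \<le> (sqrt 3 * t + C)\<^sup>2" if "dist (d t) (g z) \<le> sqrt 3 * t + C" for z
      using that by (intro power_mono) (simp_all add: dist_commute)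
    have near: "dist (d t) (g ?x) \<le> sqrt 3 * t + C" "dist (d t) (g ?y) \<le> sqrt 3 * t + C"
      using K[OF t] K'[OF t] C by linarith+
    have "(dist (l t) (d t))\<^sup>2 \<le> ((dist (g ?x) (d t))\<^sup>2 + (dist (g ?y) (d t))\<^sup>2) / 2 - (dist (g ?x) (g ?y))\<^sup>2 / 4"
      using CAT0_midpoint[OF CAT0 chart_segment[OF D(1), of ?x ?y], of "d t"] gm by simp
    also have "\<dots> \<le> (sqrt 3 * t + C)\<^sup>2 - 3 * t\<^sup>2"
      unfolding xy using sq[OF near(1)] sq[OF near(2)] by simp
    also have "\<dots> = 2 * sqrt 3 * C * t + C\<^sup>2" by (simp add: power2_sum power_mult_distrib)
    also have "\<dots> \<le> 4 * C * t + C\<^sup>2"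
    proof -
      have "sqrt 3 \<le> 2" by (rule real_le_lsqrt) simp_all
      then have "sqrt 3 * (C * t) \<le> 2 * (C * t)" using C t by (intro mult_right_mono) auto
      then show ?thesis by (simp add: mult_ac)
    qed
    finally show ?thesis .
  qed
  have "dist (l t) (d t) \<le> dist (l 0) (d 0)" if "0 \<le> t" for t
  proof (rule convex_sublinear_le[OF convex_dist_rays[OF CAT0 rays] _ that])
    have inv: "((\<lambda>t::real. C / t) \<longlongrightarrow> 0) at_top" for C
      by (intro tendsto_divide_0[OF tendsto_const] filterlim_at_top_imp_at_infinity filterlim_ident)
    show "((\<lambda>t. dist (l t) (d t) / t) \<longlongrightarrow> 0) at_top"
    proof (rule tendsto_sandwich)
      show "\<forall>\<^sub>F t in at_top. 0 \<le> dist (l t) (d t) / t" using eventually_gt_at_top[of 0] by eventually_elim auto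
      have "((\<lambda>t. 4 * C / t + (C / t)\<^sup>2) \<longlongrightarrow> 0 + 0\<^sup>2) at_top" by (intro tendsto_add tendsto_power inv)
      then show "((\<lambda>t. sqrt (4 * C / t + (C / t)\<^sup>2)) \<longlongrightarrow> 0) at_top" using tendsto_real_sqrt by fastforce
      show "\<forall>\<^sub>F t in at_top. dist (l t) (d t) / t \<le> sqrt (4 * C / t + (C / t)\<^sup>2)"
        using eventually_gt_at_top[of 0]
      proof eventually_elim
        case (elim t)
        have "(dist (l t) (d t) / t)\<^sup>2 \<le> (4 * C * t + C\<^sup>2) / t\<^sup>2"
          unfolding power_divide using bound[of t] elim by (intro divide_right_mono) auto
        also have "\<dots> = 4 * C / t + (C / t)\<^sup>2" using elim by (simp add: field_simps power2_eq_square)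
        finally show ?case by (rule real_le_rsqrt)
      qed
    qed simp
  qed
  then have "asymptotic l d" unfolding asymptotic_def by blast
  then have "ideal_point l = ideal_point d" using rays by (simp add: ideal_point_eq_iff)
  then show ?thesis using heads_ideal_point(1)[OF g(3), of 0] heads_ideal_point(1)[OF h(2), of 0]
    by (simp add: l_def[abs_def] d_def[abs_def])
qed

section \<open>Centers of projective frames\<close>

lemma frame_center_mem:
  assumes "frame_center \<F> Q y" "T \<subseteq> Q" "card T = 3" "flat_through \<F> T A"
  shows "y \<in> A"
proof -
  have "y \<in> \<Inter>{A. \<exists>T\<subseteq>Q. card T = 3 \<and> flat_through \<F> T A}"
    using assms(1) unfolding frame_center_def by simp
  then show ?thesis using assms(2-4) by blast
qed

text \<open>If no flat passed through \<open>T\<close>, then the flats intersecting in \<open>y\<close> would all contain a ray from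
  \<open>y\<close> to the point of \<open>Q\<close> missing from \<open>T\<close>.\<close>

lemma frame_center_flat_exists:
  assumes y: "frame_center \<F> Q y" and Q: "card Q = 4"
    and T\<^sub>0: "T\<^sub>0 \<subseteq> Q" "card T\<^sub>0 = 3" "flat_through \<F> T\<^sub>0 A\<^sub>0"
    and T: "T \<subseteq> Q" "card T = 3"
  shows "\<exists>A. flat_through \<F> T A"
proof (rule ccontr)
  assume no: "\<not> ?thesis"
  have "finite Q" using Q by (metis card.infinite zero_neq_numeral)
  have "card (Q - T) = 1" using T Q \<open>finite Q\<close> by (simp add: card_Diff_subset finite_subset)
  then obtain \<eta> where \<eta>: "Q - T = {\<eta>}" by (meson card_1_singletonE)
  have \<eta>_mem: "\<eta> \<in> T'" if T': "T' \<subseteq> Q" "card T' = 3" "flat_through \<F> T' A" for T' A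
  proof (rule ccontr)
    assume "\<eta> \<notin> T'"
    have "x \<in> T" if "x \<in> T'" for x
    proof (rule ccontr)
      assume "x \<notin> T"
      then have "x \<in> Q - T" using that T'(1) by (simp add: subset_iff)
      then show False using \<eta> that \<open>\<eta> \<notin> T'\<close> by simp
    qed
    then have "T' \<subseteq> T" by (rule subsetI)
    then have "T' = T" using T T'(2) finite_subset[OF T(1) \<open>finite Q\<close>] by (intro card_subset_eq) simp_all
    then show False using no T'(3) by blast
  qed
  have "y \<in> A\<^sub>0" using frame_center_mem[OF y T\<^sub>0] .
  then obtain f a where f: "f \<in> \<F>" "A\<^sub>0 = f ` model_flat" "a \<in> model_flat" "y = f a"
    using T\<^sub>0(3) unfolding flat_through_def flats_def by blast
  have "\<eta> \<in> boundary A\<^sub>0" using \<eta>_mem[OF T\<^sub>0] T\<^sub>0(3) by (auto simp: flat_through_def)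
  then obtain u where u: "heads f u \<eta>" using f boundary_iff_heads by auto
  have "f (a + 1 *\<^sub>R u) \<in> A" if A: "T' \<subseteq> Q" "card T' = 3" "flat_through \<F> T' A" for T' A
  proof -
    have "y \<in> A" using frame_center_mem[OF y A] .
    then obtain g b where g: "g \<in> \<F>" "A = g ` model_flat" "b \<in> model_flat" "y = g b"
      using A(3) unfolding flat_through_def flats_def by blast
    have "\<eta> \<in> boundary A" using \<eta>_mem[OF A] A(3) by (auto simp: flat_through_def)
    then obtain v where v: "heads g v \<eta>" using g boundary_iff_heads by auto
    have "f a = g b" using f(4) g(4) by simp
    from heads_ray_eq[OF u v f(3) g(3) this zero_le_one] have "f (a + 1 *\<^sub>R u) = g (b + 1 *\<^sub>R v)" .
    moreover have "b + 1 *\<^sub>R v \<in> model_flat" using g(3) headsD(2)[OF v] by simp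
    ultimately show ?thesis unfolding g(2) by blast
  qed
  then have "f (a + 1 *\<^sub>R u) \<in> \<Inter>{A. \<exists>T\<subseteq>Q. card T = 3 \<and> flat_through \<F> T A}" by blast
  then have "f (a + 1 *\<^sub>R u) \<in> {y}" using y unfolding frame_center_def by (simp only:)
  then have "f (a + u) = f a" using f(4) by simp
  then have "a + u = a" using chart_eq_iff[OF f(1), of "a + u" a] f(3) headsD(2)[OF u] by simp
  then show False using headsD(3)[OF u] by simp
qed

lemma frame_flats_inter:
  assumes f: "heads f (vertex i) a" "heads f (vertex j) b" "heads f (vertex k) c"
    and ijk: "i \<noteq> j" "j \<noteq> k" "i \<noteq> k"
    and B: "flat_through \<F> {a, b, d} B" and points: "{a, b, c, d} \<subseteq> proj_points \<F>" "card {a, b, c, d} = 4"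
    and y: "frame_center \<F> {a, b, c, d} (f x)" "x \<in> model_flat"
  shows "f ` model_flat \<inter> B = {f (x + s *\<^sub>R vertex i + t *\<^sub>R vertex j) | s t. 0 \<le> s \<and> 0 \<le> t}" (is "_ = ?C")
proof -
  note D = headsD[OF f(1)]
  have ne: "a \<noteq> b" "a \<noteq> c" "a \<noteq> d" "b \<noteq> c" "b \<noteq> d" "c \<noteq> d"
    using points(2) by (auto simp: card_insert_if split: if_splits)
  have cards: "card {a, b, c} = 3" "card {a, b, d} = 3" "card {a, c, d} = 3" "card {b, c, d} = 3"
    using ne by simp_all
  have "{a, b, c} \<subseteq> boundary (f ` model_flat)" using f boundary_iff_heads[OF D(1)] by blast
  then have P: "flat_through \<F> {a, b, c} (f ` model_flat)" using D(1) by (auto simp: flat_through_def flats_def)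
  note ex = frame_center_flat_exists[OF y(1) points(2) _ cards(1) P]
  note mem = frame_center_mem[OF y(1)]
  obtain G where G: "flat_through \<F> {a, c, d} G" using ex[OF _ _ cards(3)] by blast
  obtain H where H: "flat_through \<F> {b, c, d} H" using ex[OF _ _ cards(4)] by blast
  have sub: "{a, b, d} \<subseteq> proj_points \<F>" "{a, c, d} \<subseteq> proj_points \<F>" "{b, c, d} \<subseteq> proj_points \<F>"
    using points(1) by auto
  have "f x \<in> B" "f x \<in> G" "f x \<in> H"
    using mem[OF _ cards(2) B] mem[OF _ cards(3) G] mem[OF _ cards(4) H] by auto
  \<comment> \<open>In every chart \<open>a\<close>, \<open>b\<close>, \<open>c\<close> keep the
    vertices \<open>i\<close>, \<open>j\<close>, \<open>k\<close>, and \<open>d\<close> takes that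
    of the missing point, so that a cone seen in two charts has the same coefficients.\<close>
  obtain q where q: "q ` model_flat = B" "q 0 = f x" "heads q (vertex i) a" "heads q (vertex j) b" "heads q (vertex k) d"
    by (rule three_points_chart[OF B \<open>f x \<in> B\<close> sub(1) ne(1,5,3) ijk])
  obtain g where g: "g 0 = f x" "heads g (vertex i) a" "heads g (vertex k) c" "heads g (vertex j) d"
    by (rule three_points_chart[OF G \<open>f x \<in> G\<close> sub(2) ne(2,6,3) ijk(3) ijk(2)[symmetric] ijk(1)])
  obtain h where h: "h 0 = f x" "heads h (vertex j) b" "heads h (vertex k) c" "heads h (vertex i) d"
    by (rule three_points_chart[OF H \<open>f x \<in> H\<close> sub(3) ne(4,6,5) ijk(2) ijk(3)[symmetric] ijk(1)[symmetric]])
  note zero = model_flat_simps(5)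
  show ?thesis
  proof
    show "?C \<subseteq> f ` model_flat \<inter> B"
    proof
      fix z assume "z \<in> ?C"
      then obtain s t where st: "0 \<le> s" "0 \<le> t" "z = f (x + s *\<^sub>R vertex i + t *\<^sub>R vertex j)" by blast
      have "z = q (0 + s *\<^sub>R vertex i + t *\<^sub>R vertex j)" unfolding st(3)
        by (rule heads_cone_eq[OF f(1) q(3) f(2) q(4) y(2) zero q(2)[symmetric] st(1,2)])
      moreover have "0 + s *\<^sub>R vertex i + t *\<^sub>R vertex j \<in> model_flat" "x + s *\<^sub>R vertex i + t *\<^sub>R vertex j \<in> model_flat"
        using y(2) by simp_all
      ultimately show "z \<in> f ` model_flat \<inter> B" using st(3) q(1) by blast
    qed
    show "f ` model_flat \<inter> B \<subseteq> ?C"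
    proof
      fix z assume "z \<in> f ` model_flat \<inter> B"
      then obtain x\<^sub>0 x\<^sub>1 where x: "x\<^sub>0 \<in> model_flat" "z = f x\<^sub>0" "x\<^sub>1 \<in> model_flat" "z = q x\<^sub>1" unfolding q(1)[symmetric] by blast
      have "f x\<^sub>0 = q x\<^sub>1" using x by simp
      \<comment> \<open>Inner products with the directions of \<open>a\<close> and \<open>b\<close>
        agree in \<open>f\<close> and \<open>q\<close>, so \<open>z\<close> has the same coordinates
        relative to the center in both.\<close>
      note inner = heads_inner_eq[OF _ _ x(1) y(2) x(3) zero this q(2)[symmetric]]
      have "x\<^sub>0 - x = x\<^sub>1 - 0"
        using inner[OF f(1) q(3)] inner[OF f(2) q(4)] x(1,3) y(2) ijk(1) by (intro model_flat_eqI[of _ _ i j]) simp_all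
      then have x1: "x\<^sub>1 = x\<^sub>0 - x" by simp
      have "x\<^sub>0 - x \<in> model_flat" using x y(2) by simp
      then consider s t where "0 \<le> s" "0 \<le> t" "x\<^sub>0 - x = s *\<^sub>R vertex i + t *\<^sub>R vertex j"
        | s t where "0 \<le> s" "0 \<le> t" "x\<^sub>0 - x = s *\<^sub>R vertex i + t *\<^sub>R vertex k"
        | s t where "0 \<le> s" "0 \<le> t" "x\<^sub>0 - x = s *\<^sub>R vertex j + t *\<^sub>R vertex k"
        by (rule three_sectors[OF _ ijk]) metis+
      then show "z \<in> ?C"
      proof cases
        case (1 s t)
        then have "x\<^sub>0 = x + s *\<^sub>R vertex i + t *\<^sub>R vertex j" by (simp add: algebra_simps)
        then show ?thesis using 1 x(2) by blast
      next
        case (2 s t)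
        then have x0: "x\<^sub>0 = x + s *\<^sub>R vertex i + t *\<^sub>R vertex k" by (simp add: algebra_simps)
        have "z = g (0 + s *\<^sub>R vertex i + t *\<^sub>R vertex k)" unfolding x(2) x0
          by (rule heads_cone_eq[OF f(1) g(2) f(3) g(3) y(2) zero g(1)[symmetric] 2(1,2)])
        moreover have "q (0 + s *\<^sub>R vertex i + t *\<^sub>R vertex k) = g (0 + s *\<^sub>R vertex i + t *\<^sub>R vertex j)"
          by (rule heads_cone_eq[OF q(3) g(2) q(5) g(4) zero zero _ 2(1,2)]) (simp add: q g)
        ultimately have "g (0 + s *\<^sub>R vertex i + t *\<^sub>R vertex k) = g (0 + s *\<^sub>R vertex i + t *\<^sub>R vertex j)"
          using x(4) x1 2(3) by simp
        then have "t *\<^sub>R vertex k = t *\<^sub>R vertex j"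
          using chart_eq_iff[OF headsD(1)[OF g(2)], of "0 + s *\<^sub>R vertex i + t *\<^sub>R vertex k" "0 + s *\<^sub>R vertex i + t *\<^sub>R vertex j"] by simp
        then have "t = 0" using ijk by simp
        then have "x\<^sub>0 = x + s *\<^sub>R vertex i + 0 *\<^sub>R vertex j" using x0 by simp
        then show ?thesis using 2(1) x(2) by blast
      next
        case (3 s t)
        then have x0: "x\<^sub>0 = x + s *\<^sub>R vertex j + t *\<^sub>R vertex k" by (simp add: algebra_simps)
        have "z = h (0 + s *\<^sub>R vertex j + t *\<^sub>R vertex k)" unfolding x(2) x0
          by (rule heads_cone_eq[OF f(2) h(2) f(3) h(3) y(2) zero h(1)[symmetric] 3(1,2)])
        moreover have "q (0 + s *\<^sub>R vertex j + t *\<^sub>R vertex k) = h (0 + s *\<^sub>R vertex j + t *\<^sub>R vertex i)"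
          by (rule heads_cone_eq[OF q(4) h(2) q(5) h(4) zero zero _ 3(1,2)]) (simp add: q h)
        ultimately have "h (0 + s *\<^sub>R vertex j + t *\<^sub>R vertex k) = h (0 + s *\<^sub>R vertex j + t *\<^sub>R vertex i)"
          using x(4) x1 3(3) by simp
        then have "t *\<^sub>R vertex k = t *\<^sub>R vertex i"
          using chart_eq_iff[OF headsD(1)[OF h(2)], of "0 + s *\<^sub>R vertex j + t *\<^sub>R vertex k" "0 + s *\<^sub>R vertex j + t *\<^sub>R vertex i"] by simp
        then have "t = 0" using ijk by simp
        then have "x\<^sub>0 = x + 0 *\<^sub>R vertex i + s *\<^sub>R vertex j" using x0 by simp
        then show ?thesis using 3(1) x(2) by blast
      qed
    qed
  qed
qed

end

section \<open>The plane tiling\<close>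

definition cone_at :: "real^3 \<Rightarrow> real^3 \<Rightarrow> real^3 \<Rightarrow> (real^3) set" where
  "cone_at a u v = {a + s *\<^sub>R u + t *\<^sub>R v | s t. 0 \<le> s \<and> 0 \<le> t}"

lemma cone_at_vertex_iff:
  assumes "i \<noteq> j"
  shows "b + \<alpha> *\<^sub>R vertex i + \<beta> *\<^sub>R vertex j \<in> cone_at b (vertex i) (vertex j) \<longleftrightarrow> 0 \<le> \<alpha> \<and> 0 \<le> \<beta>"
proof
  assume "b + \<alpha> *\<^sub>R vertex i + \<beta> *\<^sub>R vertex j \<in> cone_at b (vertex i) (vertex j)"
  then obtain s t where st: "0 \<le> s" "0 \<le> t"
    "b + \<alpha> *\<^sub>R vertex i + \<beta> *\<^sub>R vertex j = b + s *\<^sub>R vertex i + t *\<^sub>R vertex j"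
    unfolding cone_at_def by blast
  then have "\<alpha> *\<^sub>R vertex i + \<beta> *\<^sub>R vertex j = s *\<^sub>R vertex i + t *\<^sub>R vertex j" by (simp add: add.assoc)
  then show "0 \<le> \<alpha> \<and> 0 \<le> \<beta>" using vertex_independent[OF _ assms] st(1,2) by blast
qed (auto simp: cone_at_def)

lemma vertex_eq: "vertex 3 = - vertex 1 - vertex 2" "vertex 1 = - vertex 2 - vertex 3" "vertex 2 = - vertex 3 - vertex 1"
  using vertex_sum[of 1 2 3] by (simp_all add: eq_neg_iff_add_eq_0 algebra_simps)

context
  fixes b :: "real^3" and \<tau> :: real
begin

text \<open>Coordinates centred at the apex of the first cone. All walls of the tiling have vertex
  directions, so they become bounds on \<open>\<alpha>\<close>, \<open>\<beta>\<close> and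
  \<open>\<alpha> - \<beta>\<close>.\<close>

private definition "pt \<alpha> \<beta> = b + \<alpha> *\<^sub>R vertex 1 + \<beta> *\<^sub>R vertex 2"
private abbreviation "b1 \<equiv> b - \<tau> *\<^sub>R vertex 2"
private abbreviation "b2 \<equiv> b + \<tau> *\<^sub>R vertex 1"

private lemma pt_eq_iff: "pt \<alpha> \<beta> = pt \<alpha>' \<beta>' \<longleftrightarrow> \<alpha> = \<alpha>' \<and> \<beta> = \<beta>'"
  using vertex_independent[of \<alpha> 1 \<beta> 2 \<alpha>' \<beta>'] by (auto simp: pt_def add.assoc)

private lemma pt_cases:
  assumes "x \<in> model_flat" "b \<in> model_flat" obtains \<alpha> \<beta> where "x = pt \<alpha> \<beta>"
proof -
  obtain \<alpha> \<beta> where "x - b = \<alpha> *\<^sub>R vertex 1 + \<beta> *\<^sub>R vertex 2" using vertex_decompose[of "x - b" 1 2] assms by auto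
  then have "x = pt \<alpha> \<beta>" by (simp add: pt_def algebra_simps)
  then show ?thesis by (rule that)
qed

private lemma pt_in_cone:
  "pt \<alpha> \<beta> \<in> cone_at b (vertex 1) (vertex 2) \<longleftrightarrow> 0 \<le> \<alpha> \<and> 0 \<le> \<beta>"
  "pt \<alpha> \<beta> \<in> cone_at b1 (vertex 2) (vertex 3) \<longleftrightarrow> \<alpha> \<le> 0 \<and> \<alpha> - \<beta> \<le> \<tau>"
  "pt \<alpha> \<beta> \<in> cone_at b2 (vertex 3) (vertex 1) \<longleftrightarrow> \<beta> \<le> 0 \<and> \<tau> \<le> \<alpha> - \<beta>"
proof -
  show "pt \<alpha> \<beta> \<in> cone_at b (vertex 1) (vertex 2) \<longleftrightarrow> 0 \<le> \<alpha> \<and> 0 \<le> \<beta>"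
    using cone_at_vertex_iff[of 1 2] by (simp add: pt_def)
  have "pt \<alpha> \<beta> = b1 + (\<beta> + \<tau> - \<alpha>) *\<^sub>R vertex 2 + (- \<alpha>) *\<^sub>R vertex 3"
    unfolding pt_def vertex_eq(1) by (simp add: algebra_simps)
  then show "pt \<alpha> \<beta> \<in> cone_at b1 (vertex 2) (vertex 3) \<longleftrightarrow> \<alpha> \<le> 0 \<and> \<alpha> - \<beta> \<le> \<tau>"
    using cone_at_vertex_iff[of 2 3 b1 "\<beta> + \<tau> - \<alpha>" "- \<alpha>"] by auto
  have "pt \<alpha> \<beta> = b2 + (- \<beta>) *\<^sub>R vertex 3 + (\<alpha> - \<tau> - \<beta>) *\<^sub>R vertex 1"
    unfolding pt_def vertex_eq(1) by (simp add: algebra_simps)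
  then show "pt \<alpha> \<beta> \<in> cone_at b2 (vertex 3) (vertex 1) \<longleftrightarrow> \<beta> \<le> 0 \<and> \<tau> \<le> \<alpha> - \<beta>"
    using cone_at_vertex_iff[of 3 1 b2 "- \<beta>" "\<alpha> - \<tau> - \<beta>"] by auto
qed

private lemma pt_in_triangle:
  "pt \<alpha> \<beta> \<in> convex hull {b1, b2, b} \<longleftrightarrow> (\<exists>u v. 0 \<le> u \<and> 0 \<le> v \<and> u + v \<le> 1 \<and> \<alpha> = \<tau> * v \<and> \<beta> = - \<tau> * u)"
proof -
  have comb: "u *\<^sub>R b1 + v *\<^sub>R b2 + w *\<^sub>R b = pt (\<tau> * v) (- \<tau> * u)" if "u + v + w = 1" for u v w
  proof -
    have "u *\<^sub>R b1 + v *\<^sub>R b2 + w *\<^sub>R b = (u + v + w) *\<^sub>R b + (\<tau> * v) *\<^sub>R vertex 1 + (- \<tau> * u) *\<^sub>R vertex 2"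
      by (simp add: algebra_simps)
    then show ?thesis using that by (simp add: pt_def)
  qed
  show ?thesis
  proof
    assume "pt \<alpha> \<beta> \<in> convex hull {b1, b2, b}"
    then obtain u v w where "0 \<le> u" "0 \<le> v" "0 \<le> w" "u + v + w = 1" "pt \<alpha> \<beta> = u *\<^sub>R b1 + v *\<^sub>R b2 + w *\<^sub>R b"
      unfolding convex_hull_3 by blast
    then show "\<exists>u v. 0 \<le> u \<and> 0 \<le> v \<and> u + v \<le> 1 \<and> \<alpha> = \<tau> * v \<and> \<beta> = - \<tau> * u"
      using comb[of u v w] pt_eq_iff by (intro exI[of _ u] exI[of _ v]) auto
  next
    assume "\<exists>u v. 0 \<le> u \<and> 0 \<le> v \<and> u + v \<le> 1 \<and> \<alpha> = \<tau> * v \<and> \<beta> = - \<tau> * u"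
    then obtain u v where uv: "0 \<le> u" "0 \<le> v" "u + v \<le> 1" "\<alpha> = \<tau> * v" "\<beta> = - \<tau> * u" by blast
    then have "pt \<alpha> \<beta> = u *\<^sub>R b1 + v *\<^sub>R b2 + (1 - u - v) *\<^sub>R b" using comb[of u v "1 - u - v"] by simp
    moreover have "0 \<le> 1 - u - v" "u + v + (1 - u - v) = 1" using uv by auto
    ultimately show "pt \<alpha> \<beta> \<in> convex hull {b1, b2, b}" unfolding convex_hull_3 using uv(1,2) by blast
  qed
qed

text \<open>The two disjuncts are the triangle for nonnegative and for nonpositive
  \<open>\<tau>\<close>. Each implies its own sign of \<open>\<tau>\<close>, which leaves the tiling
  to linear arithmetic without a case distinction.\<close>

private lemma pt_in_triangle_iff:
  "pt \<alpha> \<beta> \<in> convex hull {b1, b2, b} \<longleftrightarrow>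
    0 \<le> \<alpha> \<and> \<beta> \<le> 0 \<and> \<alpha> - \<beta> \<le> \<tau> \<or> \<alpha> \<le> 0 \<and> 0 \<le> \<beta> \<and> \<tau> \<le> \<alpha> - \<beta>"
  unfolding pt_in_triangle
proof
  assume "\<exists>u v. 0 \<le> u \<and> 0 \<le> v \<and> u + v \<le> 1 \<and> \<alpha> = \<tau> * v \<and> \<beta> = - \<tau> * u"
  then obtain u v where uv: "0 \<le> u" "0 \<le> v" "u + v \<le> 1" "\<alpha> = \<tau> * v" "\<beta> = - \<tau> * u" by blast
  have e: "\<alpha> - \<beta> = \<tau> * (u + v)" using uv by (simp add: algebra_simps)
  show "0 \<le> \<alpha> \<and> \<beta> \<le> 0 \<and> \<alpha> - \<beta> \<le> \<tau> \<or> \<alpha> \<le> 0 \<and> 0 \<le> \<beta> \<and> \<tau> \<le> \<alpha> - \<beta>"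
  proof (cases "0 \<le> \<tau>")
    case True
    then have "0 \<le> \<tau> * v" "0 \<le> \<tau> * u" "\<tau> * (u + v) \<le> \<tau> * 1"
      using uv(1-3) by (simp, simp, intro mult_left_mono)
    then show ?thesis using uv(4,5) e by simp
  next
    case False
    then have "\<tau> * v \<le> 0" "\<tau> * u \<le> 0" "\<tau> * 1 \<le> \<tau> * (u + v)" using uv
      by (simp_all add: mult_nonpos_nonneg mult_left_mono_neg)
    then show ?thesis using uv(4,5) e by simp
  qed
next
  assume *: "0 \<le> \<alpha> \<and> \<beta> \<le> 0 \<and> \<alpha> - \<beta> \<le> \<tau> \<or> \<alpha> \<le> 0 \<and> 0 \<le> \<beta> \<and> \<tau> \<le> \<alpha> - \<beta>"
  show "\<exists>u v. 0 \<le> u \<and> 0 \<le> v \<and> u + v \<le> 1 \<and> \<alpha> = \<tau> * v \<and> \<beta> = - \<tau> * u"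
  proof (cases "\<tau> = 0")
    case True
    then show ?thesis using * by (intro exI[of _ 0]) auto
  next
    case False
    have "0 \<le> - \<beta> / \<tau>" "0 \<le> \<alpha> / \<tau>" "- \<beta> / \<tau> + \<alpha> / \<tau> \<le> 1"
      using * False by (auto simp: zero_le_divide_iff divide_le_eq simp flip: add_divide_distrib diff_divide_distrib)
    then show ?thesis using False by (intro exI[of _ "- \<beta> / \<tau>"] exI[of _ "\<alpha> / \<tau>"]) auto
  qed
qed

lemma cones_triangle_cover:
  assumes "x \<in> model_flat" "b \<in> model_flat"
  shows "x \<in> cone_at b (vertex 1) (vertex 2) \<union> cone_at (b - \<tau> *\<^sub>R vertex 2) (vertex 2) (vertex 3)
    \<union> cone_at (b + \<tau> *\<^sub>R vertex 1) (vertex 3) (vertex 1)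
    \<union> convex hull {b - \<tau> *\<^sub>R vertex 2, b + \<tau> *\<^sub>R vertex 1, b}"
proof -
  obtain \<alpha> \<beta> where x: "x = pt \<alpha> \<beta>" using pt_cases assms .
  show ?thesis unfolding x Un_iff pt_in_cone pt_in_triangle_iff by linarith
qed

text \<open>Two pieces meet only along walls, and each vector crosses every wall on which they can
  meet. The wall between \<open>A\<close> and \<open>T\<close> has direction \<open>vertex 1\<close>
  or \<open>vertex 2\<close> according to the sign of \<open>\<tau>\<close>, hence the sum of
  both.\<close>

lemma cones_triangle_disjoint:
  assumes "x \<in> model_flat" "b \<in> model_flat" "0 < c"
  defines "A \<equiv> cone_at b (vertex 1) (vertex 2)"
    and "B \<equiv> cone_at (b - \<tau> *\<^sub>R vertex 2) (vertex 2) (vertex 3)"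
    and "C \<equiv> cone_at (b + \<tau> *\<^sub>R vertex 1) (vertex 3) (vertex 1)"
    and "T \<equiv> convex hull {b - \<tau> *\<^sub>R vertex 2, b + \<tau> *\<^sub>R vertex 1, b}"
  shows "x \<in> A \<inter> B \<Longrightarrow> x + c *\<^sub>R vertex 1 \<notin> A \<inter> B"
    "x \<in> A \<inter> C \<Longrightarrow> x + c *\<^sub>R vertex 2 \<notin> A \<inter> C"
    "x \<in> B \<inter> C \<Longrightarrow> x + c *\<^sub>R vertex 1 \<notin> B \<inter> C"
    "x \<in> A \<inter> T \<Longrightarrow> x + c *\<^sub>R (vertex 1 + vertex 2) \<notin> A \<inter> T"
    "x \<in> B \<inter> T \<Longrightarrow> x + c *\<^sub>R vertex 1 \<notin> B \<inter> T"
    "x \<in> C \<inter> T \<Longrightarrow> x + c *\<^sub>R vertex 2 \<notin> C \<inter> T"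
proof -
  obtain \<alpha> \<beta> where x: "x = pt \<alpha> \<beta>" using pt_cases assms(1,2) .
  have shift: "pt \<alpha> \<beta> + c *\<^sub>R vertex 1 = pt (\<alpha> + c) \<beta>" "pt \<alpha> \<beta> + c *\<^sub>R vertex 2 = pt \<alpha> (\<beta> + c)"
    "pt \<alpha> \<beta> + c *\<^sub>R (vertex 1 + vertex 2) = pt (\<alpha> + c) (\<beta> + c)"
    by (simp_all add: pt_def algebra_simps)
  note simps = x shift Int_iff A_def B_def C_def T_def pt_in_cone pt_in_triangle_iff
  show "x \<in> A \<inter> B \<Longrightarrow> x + c *\<^sub>R vertex 1 \<notin> A \<inter> B" unfolding simps using \<open>0 < c\<close> by linarith
  show "x \<in> A \<inter> C \<Longrightarrow> x + c *\<^sub>R vertex 2 \<notin> A \<inter> C" unfolding simps using \<open>0 < c\<close> by linarith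
  show "x \<in> B \<inter> C \<Longrightarrow> x + c *\<^sub>R vertex 1 \<notin> B \<inter> C" unfolding simps using \<open>0 < c\<close> by linarith
  show "x \<in> A \<inter> T \<Longrightarrow> x + c *\<^sub>R (vertex 1 + vertex 2) \<notin> A \<inter> T" unfolding simps using \<open>0 < c\<close> by linarith
  show "x \<in> B \<inter> T \<Longrightarrow> x + c *\<^sub>R vertex 1 \<notin> B \<inter> T" unfolding simps using \<open>0 < c\<close> by linarith
  show "x \<in> C \<inter> T \<Longrightarrow> x + c *\<^sub>R vertex 2 \<notin> C \<inter> T" unfolding simps using \<open>0 < c\<close> by linarith
qed

end

section \<open>Sectors, hulls and interiors in a chart\<close>

lemma cone_at_model_flat:
  "a \<in> model_flat \<Longrightarrow> u \<in> model_flat \<Longrightarrow> v \<in> model_flat \<Longrightarrow> cone_at a u v \<subseteq> model_flat"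
  by (auto simp: cone_at_def)

lemma convex_hull_model_flat: "X \<subseteq> model_flat \<Longrightarrow> convex hull X \<subseteq> model_flat"
  by (intro hull_minimal subspace_imp_convex subspace_model_flat)

context A2_building begin

text \<open>\<open>sector\<close> admits all markings of the flat and directions of any length;
  \<open>heads_cone_eq\<close> removes the choice of marking, and the lengths are absorbed into
  \<open>s\<close> and \<open>t\<close>.\<close>

lemma sector_eq:
  assumes \<xi>: "heads f u \<xi>" and \<eta>: "heads f v \<eta>" and x: "x \<in> model_flat"
  shows "sector \<F> (f ` model_flat) (f x) \<xi> \<eta> = f ` cone_at x u v"
proof
  show "sector \<F> (f ` model_flat) (f x) \<xi> \<eta> \<subseteq> f ` cone_at x u v"
  proof
    fix z assume "z \<in> sector \<F> (f ` model_flat) (f x) \<xi> \<eta>"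
    then obtain g a u' v' s t where z: "z = g (a + s *\<^sub>R u' + t *\<^sub>R v')" and g: "g \<in> \<F>" "a \<in> model_flat" "u' \<in> model_flat"
      "v' \<in> model_flat" "g a = f x" "flat_ray g a u' \<in> \<xi>" "flat_ray g a v' \<in> \<eta>" and st: "0 \<le> s" "0 \<le> t"
      unfolding sector_def by blast
    have u': "heads g (sgn u') \<xi>" and v': "heads g (sgn v') \<eta>"
      using heads_of_flat_ray(2)[OF \<xi> g(1-3,6)] heads_of_flat_ray(2)[OF \<eta> g(1,2,4,7)] .
    have "z = g (a + (s * norm u') *\<^sub>R sgn u' + (t * norm v') *\<^sub>R sgn v')"
    proof -
      have "(r * norm w) *\<^sub>R sgn w = r *\<^sub>R w" for r and w :: "real^3"
        by (cases "w = 0") (simp_all add: sgn_div_norm mult.assoc)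
      then show ?thesis unfolding z by simp
    qed
    also have "\<dots> = f (x + (s * norm u') *\<^sub>R u + (t * norm v') *\<^sub>R v)"
      by (rule heads_cone_eq[OF u' \<xi> v' \<eta> g(2) x g(5)]) (use st in simp_all)
    finally have "z = f (x + (s * norm u') *\<^sub>R u + (t * norm v') *\<^sub>R v)" .
    moreover have "0 \<le> s * norm u'" "0 \<le> t * norm v'" using st by simp_all
    ultimately show "z \<in> f ` cone_at x u v" unfolding cone_at_def by blast
  qed
  show "f ` cone_at x u v \<subseteq> sector \<F> (f ` model_flat) (f x) \<xi> \<eta>"
    using headsD[OF \<xi>] headsD[OF \<eta>] x flat_ray_of_heads[OF \<xi> x] flat_ray_of_heads[OF \<eta> x]
    unfolding sector_def cone_at_def by blast
qed

text \<open>Two markings of one flat differ by an affine map, and affine maps commute with convex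
  hulls.\<close>

lemma flat_hull_eq:
  assumes f: "f \<in> \<F>" and X: "X \<subseteq> model_flat"
  shows "flat_hull \<F> (f ` model_flat) (f ` X) = f ` (convex hull X)"
proof
  show "flat_hull \<F> (f ` model_flat) (f ` X) \<subseteq> f ` (convex hull X)"
  proof
    fix z assume "z \<in> flat_hull \<F> (f ` model_flat) (f ` X)"
    then obtain g b where z: "z = g b" and g: "g \<in> \<F>" "g ` model_flat = f ` model_flat"
      and b: "b \<in> convex hull {a \<in> model_flat. g a \<in> f ` X}"
      unfolding flat_hull_def by blast
    let ?Y = "{a \<in> model_flat. g a \<in> f ` X}"
    obtain w c where w: "w \<in> Weyl_group" "c \<in> model_flat"
      "\<And>x y. x \<in> model_flat \<Longrightarrow> y \<in> model_flat \<Longrightarrow> f x = g y \<Longrightarrow> x = w y + c"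
      using chart_transition[OF f g(1)] by blast
    have gf: "g y = f (w y + c)" if y: "y \<in> model_flat" for y
    proof -
      have "g y \<in> f ` model_flat" using y g(2) by blast
      then obtain x where "x \<in> model_flat" "g y = f x" by blast
      then show ?thesis using w(3)[of x y] y by simp
    qed
    have "(\<lambda>v. c + v) ` w ` ?Y \<subseteq> X"
    proof
      fix x assume "x \<in> (\<lambda>v. c + v) ` w ` ?Y"
      then obtain y where y: "x = c + w y" "y \<in> model_flat" "g y \<in> f ` X" by blast
      then obtain x' where x': "x' \<in> X" "g y = f x'" by blast
      then have "x' = w y + c" using w(3)[of x' y] X y(2) by auto
      then show "x \<in> X" using y(1) x'(1) by (simp add: add.commute)
    qed
    then have "convex hull ((\<lambda>v. c + v) ` w ` ?Y) \<subseteq> convex hull X" by (rule hull_mono)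
    then have "(\<lambda>v. c + v) ` w ` (convex hull ?Y) \<subseteq> convex hull X"
      by (simp only: convex_hull_translation convex_hull_linear_image[OF Weyl_group_linear[OF w(1)]])
    then have "c + w b \<in> convex hull X" using b by blast
    moreover have "b \<in> model_flat" using b convex_hull_model_flat[of ?Y] by blast
    ultimately show "z \<in> f ` (convex hull X)" using gf[of b] z by (metis add.commute imageI)
  qed
  have "X \<subseteq> {a \<in> model_flat. f a \<in> f ` X}" using X by blast
  then have "convex hull X \<subseteq> convex hull {a \<in> model_flat. f a \<in> f ` X}" by (rule hull_mono)
  then show "f ` (convex hull X) \<subseteq> flat_hull \<F> (f ` model_flat) (f ` X)"
    unfolding flat_hull_def using f by blast
qed

text \<open>A common interior point would stay in both sets after a small shift along
  \<open>n\<close>, which \<open>thin\<close> forbids.\<close>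

lemma disjoint_interiors:
  assumes f: "f \<in> \<F>" and X: "X \<subseteq> model_flat" "Y \<subseteq> model_flat" and n: "n \<in> model_flat"
    and thin: "\<And>x c. x \<in> X \<inter> Y \<Longrightarrow> 0 < c \<Longrightarrow> x + c *\<^sub>R n \<notin> X \<inter> Y"
  shows "(top_of_set (f ` model_flat)) interior_of (f ` X) \<inter> (top_of_set (f ` model_flat)) interior_of (f ` Y) = {}"
    (is "?U \<inter> ?V = {}")
proof (rule ccontr)
  assume "?U \<inter> ?V \<noteq> {}"
  then obtain z where z: "z \<in> ?U \<inter> ?V" by blast
  have "inj_on f model_flat" using chart_eq_iff[OF f] by (auto simp: inj_on_def)
  then have "f ` X \<inter> f ` Y = f ` (X \<inter> Y)" using X by (simp add: inj_on_image_Int)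
  moreover have "?U \<inter> ?V \<subseteq> f ` X \<inter> f ` Y" by (intro Int_mono interior_of_subset)
  ultimately have sub: "?U \<inter> ?V \<subseteq> f ` (X \<inter> Y)" by simp
  then have "z \<in> f ` (X \<inter> Y)" using z by (rule subsetD)
  then obtain x where x: "x \<in> X \<inter> Y" "z = f x" by blast
  have "openin (top_of_set (f ` model_flat)) (?U \<inter> ?V)" by (intro openin_Int openin_interior_of)
  then obtain e where e: "0 < e" "ball z e \<inter> f ` model_flat \<subseteq> ?U \<inter> ?V"
    using z unfolding openin_contains_ball by blast
  define c where "c = e / (norm n + 1)"
  have c: "0 < c" "c * norm n < e"
  proof -
    have "0 < norm n + 1" by (simp add: add_nonneg_pos)
    then show "0 < c" "c * norm n < e" using e(1) by (simp_all add: c_def pos_divide_less_eq)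
  qed
  have xm: "x \<in> model_flat" "x + c *\<^sub>R n \<in> model_flat" using x X n by auto
  have "dist z (f (x + c *\<^sub>R n)) = c * norm n"
    using chart_dist[OF f xm] c x(2) by (simp add: dist_norm)
  then have "f (x + c *\<^sub>R n) \<in> ball z e \<inter> f ` model_flat" using c xm(2) by simp
  then have "f (x + c *\<^sub>R n) \<in> f ` (X \<inter> Y)" using e(2) sub by blast
  then obtain x' where "x' \<in> X \<inter> Y" "f (x + c *\<^sub>R n) = f x'" by blast
  moreover from this have "x + c *\<^sub>R n = x'" using chart_eq_iff[OF f xm(2), of x'] X by blast
  ultimately show False using thin[OF x(1) c(1)] by simp
qed

text \<open>The direction \<open>- vertex k\<close> is adjacent to \<open>vertex i\<close> and
  \<open>vertex j\<close>, so it points to the line joining \<open>a\<close> and \<open>b\<close>.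
  Uniqueness of that line shows that \<open>D\<close> is at infinity of this flat.\<close>

lemma line_heads:
  assumes "heads f (vertex i) a" "heads f (vertex j) b" "i \<noteq> j" "j \<noteq> k" "i \<noteq> k"
    "incident \<F> a D" "incident \<F> b D"
  shows "heads f (- vertex k) D"
proof -
  define L where "L = ideal_point (\<lambda>t. f (t *\<^sub>R (- vertex k)))"
  have L: "heads f (- vertex k) L" using headsD(1)[OF assms(1)] by (simp add: heads_def L_def)
  then show ?thesis using line_through_points_unique[OF assms(1,2) L assms(3-7)] by simp
qed

text \<open>The vertices of the apartment joining two opposite flags form a hexagon, whose sixth vertex
  is the intersection of the two lines.\<close>

lemma flat_joining_contains_meet:
  assumes A: "flat_joining \<F> (p, D) (p', D') A"
    and inc: "incident \<F> p D" "incident \<F> p' D'" "\<not> incident \<F> p D'" "\<not> incident \<F> p' D"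
  obtains q where "q \<in> boundary A" "incident \<F> q D" "incident \<F> q D'"
proof -
  obtain f where f: "f \<in> \<F>" "A = f ` model_flat" using A unfolding flat_joining_def flats_def by blast
  have bd: "\<xi> \<in> {p, D, p', D'} \<Longrightarrow> \<exists>u. heads f u \<xi>" for \<xi>
    using A boundary_iff_heads[OF f(1)] f(2) unfolding flat_joining_def by auto
  have types: "p \<in> proj_points \<F>" "p' \<in> proj_points \<F>" "D \<in> proj_lines \<F>" "D' \<in> proj_lines \<F>"
    using inc(1,2) by (simp_all add: incident_def)
  obtain \<alpha> where \<alpha>: "heads f (vertex \<alpha>) p" using bd[of p] heads_proj_point types(1) by (metis insertI1)
  obtain \<gamma> where \<gamma>: "heads f (vertex \<gamma>) p'" using bd[of p'] heads_proj_point types(2) by (metis insertCI)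
  obtain \<beta> where \<beta>: "heads f (- vertex \<beta>) D" using bd[of D] heads_proj_line types(3) by (metis insertCI)
  obtain \<delta> where \<delta>: "heads f (- vertex \<delta>) D'" using bd[of D'] heads_proj_line types(4) by (metis insertCI)
  have "\<alpha> \<noteq> \<beta>" "\<gamma> \<noteq> \<delta>" "\<alpha> = \<delta>" "\<gamma> = \<beta>"
    using inc incident_iff[OF \<alpha> \<beta>] incident_iff[OF \<gamma> \<delta>] incident_iff[OF \<alpha> \<delta>] incident_iff[OF \<gamma> \<beta>] by simp_all
  obtain k where k: "k \<noteq> \<beta>" "k \<noteq> \<delta>" by (rule obtain_third)
  define q where "q = ideal_point (\<lambda>t. f (t *\<^sub>R vertex k))"
  have q: "heads f (vertex k) q" using f(1) by (simp add: heads_def q_def)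
  show ?thesis
  proof (rule that)
    show "q \<in> boundary A" using q boundary_iff_heads[OF f(1)] f(2) by blast
    show "incident \<F> q D" "incident \<F> q D'" using incident_iff[OF q \<beta>] incident_iff[OF q \<delta>] k by simp_all
  qed
qed

text \<open>The rays to \<open>D\<close> from a common point of the three flats agree in \<open>g\<close> and \<open>h\<close>, and \<open>D\<close> is opposite to
  \<open>a\<close> in both. So moving away from \<open>a\<close> in \<open>f\<close>, one stays in \<open>h\<close> for as long as in \<open>g\<close>.\<close>

lemma apex_le:
  assumes f: "heads f (vertex i) a" "heads f (vertex k) c"
    and g: "heads g (vertex i) a" "heads g (vertex k) c" "heads g (- vertex i) D"
    and h: "heads h (- vertex i) D" and "i \<noteq> k" and x: "x \<in> model_flat" and y: "y \<in> model_flat"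
    and fg: "f ` model_flat \<inter> g ` model_flat = f ` cone_at x (vertex i) (vertex k)"
    and fh: "f ` model_flat \<inter> h ` model_flat = f ` cone_at y (vertex i) (vertex k)"
    and xy: "x - y = \<alpha> *\<^sub>R vertex i + \<beta> *\<^sub>R vertex k"
  shows "0 \<le> \<alpha>"
proof -
  note D = headsD(1)[OF f(1)]
  \<comment> \<open>These lengths push \<open>z\<close> far enough to lie in both cones. Moving back
    by \<open>s\<close>, away from \<open>a\<close>, leads to \<open>z'\<close> on the edge of the
    cone at \<open>x\<close>, still in \<open>g\<close>; once it is known to be in \<open>h\<close>,
    its coefficient \<open>\<alpha>\<close> relative to \<open>y\<close> must be
    nonnegative.\<close>
  define s t where "s = \<bar>\<alpha>\<bar>" and "t = \<bar>\<beta>\<bar>"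
  define z where "z = x + s *\<^sub>R vertex i + t *\<^sub>R vertex k"
  define z' where "z' = x + 0 *\<^sub>R vertex i + t *\<^sub>R vertex k"
  have zm: "z \<in> model_flat" "z' \<in> model_flat" using x by (simp_all add: z_def z'_def)
  have x_eq: "x = y + \<alpha> *\<^sub>R vertex i + \<beta> *\<^sub>R vertex k" using xy by (simp add: algebra_simps)
  have z_eq: "z = y + (s + \<alpha>) *\<^sub>R vertex i + (t + \<beta>) *\<^sub>R vertex k"
    and z'_eq: "z' = y + \<alpha> *\<^sub>R vertex i + (t + \<beta>) *\<^sub>R vertex k"
    unfolding z_def z'_def x_eq by (simp_all add: algebra_simps)
  have "z \<in> cone_at x (vertex i) (vertex k)" "z' \<in> cone_at x (vertex i) (vertex k)"
    unfolding z_def z'_def cone_at_vertex_iff[OF \<open>i \<noteq> k\<close>] by (simp_all add: s_def t_def)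
  then have "f z \<in> g ` model_flat" "f z' \<in> g ` model_flat" using fg by blast+
  then obtain z1 z1' where z1: "z1 \<in> model_flat" "f z = g z1" "z1' \<in> model_flat" "f z' = g z1'" by blast
  have "z \<in> cone_at y (vertex i) (vertex k)"
    unfolding z_eq cone_at_vertex_iff[OF \<open>i \<noteq> k\<close>] s_def t_def by linarith
  then have "f z \<in> h ` model_flat" using fh by blast
  then obtain z2 where z2: "z2 \<in> model_flat" "f z = h z2" by blast
  \<comment> \<open>The displacement from \<open>z\<close> to \<open>z'\<close> is the same in
    \<open>f\<close> and \<open>g\<close>; in \<open>g\<close> it follows the ray to
    \<open>D\<close>, which \<open>h\<close> shares.\<close>
  note inner = heads_inner_eq[OF _ _ zm(2,1) z1(3,1) z1(4,2)]
  have "z' - z = z1' - z1"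
    using inner[OF f(1) g(1)] inner[OF f(2) g(2)] zm z1(1,3) \<open>i \<noteq> k\<close> by (intro model_flat_eqI[of _ _ i k]) simp_all
  then have "z1' = z1 + s *\<^sub>R (- vertex i)" by (simp add: z_def z'_def algebra_simps)
  moreover have "g (z1 + s *\<^sub>R (- vertex i)) = h (z2 + s *\<^sub>R (- vertex i))"
    by (rule heads_ray_eq[OF g(3) h z1(1) z2(1)]) (use z1(2) z2(2) in \<open>simp_all add: s_def\<close>)
  moreover have "z2 + s *\<^sub>R (- vertex i) \<in> model_flat" using z2(1) by simp
  ultimately have "f z' \<in> f ` model_flat \<inter> h ` model_flat" using z1(4) zm(2) by (metis IntI imageI)
  then obtain z'' where "f z' = f z''" "z'' \<in> cone_at y (vertex i) (vertex k)" using fh by blast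
  moreover from this have "z' = z''"
    using chart_eq_iff[OF D zm(2), of z''] cone_at_model_flat[OF y vertex_model_flat vertex_model_flat] by blast
  ultimately show "0 \<le> \<alpha>" unfolding z'_eq using cone_at_vertex_iff[OF \<open>i \<noteq> k\<close>, of y \<alpha> "t + \<beta>"] by blast
qed

end

section \<open>The tiling of the flat through the three points\<close>

lemma distinct_succ_3: "i \<noteq> i + 1" "i + 1 \<noteq> i + 2" "i \<noteq> i + (2::3)"
  using exhaust_3[of i] by auto

theorem proposition4p5:
  fixes \<F> :: "(real^3 \<Rightarrow> 'a::metric_space) set"
    and F :: "3 \<Rightarrow> 'a flag"
    and p D :: "3 \<Rightarrow> 'a ideal_pt"
    and pp :: "3 \<Rightarrow> 3 \<Rightarrow> 'a ideal_pt"
    and A :: "3 \<Rightarrow> 3 \<Rightarrow> 'a set"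
    and A\<^sub>p \<Delta> :: "'a set"
    and y :: "3 \<Rightarrow> 'a"
    and S :: "3 \<Rightarrow> 'a set"
  assumes building: "euclidean_building_A2 \<F>"
    and F: "\<And>i. F i = (p i, D i)"
    and generic: "generic_triple \<F> F"
    and A: "\<And>i j. i \<noteq> j \<Longrightarrow> flat_joining \<F> (F i) (F j) (A i j)"
    and A\<^sub>p: "flat_through \<F> {p 1, p 2, p 3} A\<^sub>p"
    and pp: "\<And>i j. i \<noteq> j \<Longrightarrow> points_on \<F> (D i) \<inter> points_on \<F> (D j) = {pp i j}"
    and y: "\<And>i j k. {i, j, k} = {1, 2, 3} \<Longrightarrow> frame_center \<F> {p 1, p 2, p 3, pp i j} (y k)"
    and S: "\<And>i. S i = A\<^sub>p \<inter> A i (i + 1)"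
    and \<Delta>: "\<Delta> = flat_hull \<F> A\<^sub>p {y 1, y 2, y 3}"
  shows "(\<forall>i. S i = sector \<F> A\<^sub>p (y (i + 2)) (p i) (p (i + 1))) \<and>
    (S 1 \<union> S 2 \<union> S 3 \<union> \<Delta> = A\<^sub>p \<and>
     (\<forall>i j. i \<noteq> j \<longrightarrow>
        (top_of_set A\<^sub>p) interior_of (S i) \<inter> (top_of_set A\<^sub>p) interior_of (S j) = {}) \<and>
     (\<forall>i. (top_of_set A\<^sub>p) interior_of (S i) \<inter> (top_of_set A\<^sub>p) interior_of \<Delta> = {}))"
proof -
  interpret A2_building \<F>
    using building by unfold_locales (auto simp: euclidean_building_A2_def)
  have pD: "incident \<F> (p i) (D i)" for i
  proof -
    have "F i \<in> flags \<F>" using generic by (simp add: generic_triple_def)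
    then show ?thesis using F by (simp add: flags_def)
  qed
  have not_inc: "\<not> incident \<F> (p i) (D j)" if "i \<noteq> j" for i j
  proof -
    have "opposite \<F> (F i) (F j)" using generic that by (simp add: generic_triple_def)
    then show ?thesis using F by (simp add: opposite_def)
  qed
  have pp_inc: "incident \<F> (pp i j) (D i)" "incident \<F> (pp i j) (D j)" if "i \<noteq> j" for i j
    using pp[OF that] by (auto simp: points_on_def)
  have points: "p i \<in> proj_points \<F>" for i using pD[of i] by (simp add: incident_def)
  have pp_points: "pp i j \<in> proj_points \<F>" if "i \<noteq> j" for i j
    using pp_inc[OF that] by (simp add: incident_def)
  have p_ne: "p i \<noteq> p j" if "i \<noteq> j" for i j using pD[of i] not_inc[of j i] that by auto
  \<comment> \<open>\<open>p l\<close> lies on \<open>D l\<close> but on no other \<open>D\<close>,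
    whereas \<open>pp i j\<close> lies on two of them.\<close>
  have pp_ne: "pp i j \<noteq> p l" if "i \<noteq> j" for i j l
    using pp_inc[OF that] not_inc[of l i] not_inc[of l j] that by (cases "l = i") auto
  have univ: "{i, j, k} = {1, 2, 3}" if "i \<noteq> j" "j \<noteq> k" "i \<noteq> k" for i j k :: 3
    using third_cases[OF that] UNIV_3 by auto
  have ppp: "{p 1, p 2, p 3} = {p i, p j, p k}" if "i \<noteq> j" "j \<noteq> k" "i \<noteq> k" for i j k
    using arg_cong[OF univ[OF that], of "(`) p"] by simp
  have center: "frame_center \<F> {p i, p j, p k, pp i j} (y k)" if "i \<noteq> j" "j \<noteq> k" "i \<noteq> k" for i j k
  proof -
    have "{p 1, p 2, p 3, pp i j} = insert (pp i j) {p 1, p 2, p 3}" by blast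
    also have "\<dots> = {p i, p j, p k, pp i j}" unfolding ppp[OF that] by blast
    finally show ?thesis using y[OF univ[OF that]] by simp
  qed
  have frame: "card {p i, p j, p k, pp i j} = 4" "{p i, p j, p k, pp i j} \<subseteq> proj_points \<F>"
    if "i \<noteq> j" "j \<noteq> k" "i \<noteq> k" for i j k
    using that p_ne pp_ne[of i j, symmetric] points pp_points by simp_all
  have through: "flat_through \<F> {p i, p j, p k} A\<^sub>p" if "i \<noteq> j" "j \<noteq> k" "i \<noteq> k" for i j k
    using A\<^sub>p ppp[OF that] by simp
  have card3: "card {p i, p j, p k} = 3" if "i \<noteq> j" "j \<noteq> k" "i \<noteq> k" for i j k
    using that p_ne by simp
  have y_in: "y k \<in> A\<^sub>p" for k
  proof -
    obtain i where i: "i \<noteq> k" using obtain_third[of k k] by metis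
    obtain j where j: "j \<noteq> i" "j \<noteq> k" by (rule obtain_third)
    note ijk = j(1)[symmetric] j(2) i
    show ?thesis by (rule frame_center_mem[OF center[OF ijk] _ card3[OF ijk] through[OF ijk]]) blast
  qed
  obtain f where f: "f ` model_flat = A\<^sub>p" and f123: "heads f (vertex 1) (p 1)" "heads f (vertex 2) (p 2)" "heads f (vertex 3) (p 3)"
    by (rule three_points_chart[where i = 1 and j = 2 and k = 3, OF A\<^sub>p y_in[of 1]]) (use points p_ne in auto)
  have heads_p: "heads f (vertex i) (p i)" for i using f123 exhaust_3[of i] by metis
  note f_chart = headsD(1)[OF f123(1)]
  have "\<exists>x. x \<in> model_flat \<and> y k = f x" for k using y_in[of k] f by blast
  then obtain b where b: "\<And>k. b k \<in> model_flat" "\<And>k. y k = f (b k)" by metis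
  \<comment> \<open>Makes the flat joining two flags a flat of the frame whose fourth point is
    \<open>pp i j\<close>.\<close>
  have flat_A: "flat_through \<F> {p i, p j, pp i j} (A i j)" if ij: "i \<noteq> j" for i j
  proof -
    have J: "flat_joining \<F> (p i, D i) (p j, D j) (A i j)" using A[OF ij] F by simp
    obtain q where q: "q \<in> boundary (A i j)" "incident \<F> q (D i)" "incident \<F> q (D j)"
      by (rule flat_joining_contains_meet[OF J pD pD not_inc[OF ij] not_inc[OF ij[symmetric]]])
    then have "q \<in> points_on \<F> (D i) \<inter> points_on \<F> (D j)" by (simp add: points_on_def)
    then have "q = pp i j" using pp[OF ij] by simp
    then show ?thesis using q(1) J by (simp add: flat_through_def flat_joining_def)
  qed
  \<comment> \<open>Two labellings: \<open>i, j, k\<close> fix the frame with center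
    \<open>y k\<close>, while \<open>l, m\<close> are the points \<open>p\<close> at infinity of the
    flat, possibly another pair.\<close>
  have inter_frame: "A\<^sub>p \<inter> B = f ` cone_at (b k) (vertex l) (vertex m)"
    if ijk: "i \<noteq> j" "j \<noteq> k" "i \<noteq> k" and lmn: "l \<noteq> m" "m \<noteq> n" "l \<noteq> n" and B: "flat_through \<F> {p l, p m, pp i j} B"
    for i j k l m n B
  proof -
    have "{p l, p m, p n, pp i j} = insert (pp i j) {p l, p m, p n}" by blast
    also have "\<dots> = insert (pp i j) {p i, p j, p k}" using ppp[OF ijk] ppp[OF lmn] by simp
    also have "\<dots> = {p i, p j, p k, pp i j}" by blast
    finally have Q: "{p l, p m, p n, pp i j} = {p i, p j, p k, pp i j}" .
    have "A\<^sub>p \<inter> B = {f (b k + s *\<^sub>R vertex l + t *\<^sub>R vertex m) | s t. 0 \<le> s \<and> 0 \<le> t}"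
      unfolding f[symmetric]
      by (rule frame_flats_inter[OF heads_p heads_p heads_p lmn B])
        (use Q frame[OF ijk] center[OF ijk] b in simp_all)
    also have "\<dots> = f ` cone_at (b k) (vertex l) (vertex m)" unfolding cone_at_def by blast
    finally show ?thesis .
  qed
  have y_mem: "y k \<in> B" if ijk: "i \<noteq> j" "j \<noteq> k" "i \<noteq> k" and lm: "l \<noteq> m" and B: "flat_through \<F> {p l, p m, pp i j} B"
    for i j k l m B
  proof (rule frame_center_mem[OF center[OF ijk] _ _ B])
    have "p l \<in> {p i, p j, p k}" for l using third_cases[OF ijk, of l] by (elim disjE) simp_all
    then show "{p l, p m, pp i j} \<subseteq> {p i, p j, p k, pp i j}" by blast
    show "card {p l, p m, pp i j} = 3" using p_ne[OF lm] pp_ne[OF ijk(1), symmetric] by simp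
  qed
  \<comment> \<open>As \<open>m\<close> is \<open>i\<close> or \<open>j\<close>, the line
    \<open>D m\<close> joins \<open>p m\<close> and \<open>pp i j\<close>; hence it is opposite to
    the third point \<open>p l\<close> of the flat.\<close>
  have chart: "\<exists>g. g ` model_flat = B \<and> heads g (vertex l) (p l) \<and> heads g (vertex m) (p m) \<and> heads g (- vertex l) (D m)"
    if ijk: "i \<noteq> j" "j \<noteq> k" "i \<noteq> k" and lmn: "l \<noteq> m" "m \<noteq> n" "l \<noteq> n" and B: "flat_through \<F> {p l, p m, pp i j} B"
      and m: "m = i \<or> m = j" for i j k l m n B
  proof -
    obtain g where g: "g ` model_flat = B" "heads g (vertex l) (p l)" "heads g (vertex m) (p m)" "heads g (vertex n) (pp i j)"
      by (rule three_points_chart[OF B y_mem[OF ijk lmn(1) B] _ p_ne[OF lmn(1)] pp_ne[OF ijk(1), symmetric] pp_ne[OF ijk(1), symmetric] lmn])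
        (use points pp_points[OF ijk(1)] in auto)
    have "incident \<F> (pp i j) (D m)" using pp_inc[OF ijk(1)] m by auto
    then have "heads g (- vertex l) (D m)" using line_heads[OF g(3,4) lmn(2) _ _ pD] lmn by auto
    then show ?thesis using g by blast
  qed
  \<comment> \<open>\<open>A i k\<close> belongs to the frame with center \<open>y j\<close>, and
    \<open>G\<close> to the one with center \<open>y i\<close>. Both have \<open>p i\<close>,
    \<open>p k\<close> and \<open>D k\<close> at infinity in the same positions, so
    \<open>apex_le\<close> applies in either order and the coefficient on \<open>vertex i\<close>
    vanishes.\<close>
  have parallel: "\<exists>\<beta>. b j - b i = \<beta> *\<^sub>R vertex k" if ijk: "i \<noteq> j" "j \<noteq> k" "i \<noteq> k" for i j k
  proof -
    note ikj = ijk(3) ijk(2)[symmetric] ijk(1) and jki = ijk(2) ijk(3)[symmetric] ijk(1)[symmetric]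
    have sub: "{p j, p k, p i} \<subseteq> {p j, p k, p i, pp j k}" "{p i, p k, pp j k} \<subseteq> {p j, p k, p i, pp j k}" by blast+
    have "card {p i, p k, pp j k} = 3" using p_ne[OF ijk(3)] pp_ne[OF ijk(2), symmetric] by simp
    with frame_center_flat_exists[OF center[OF jki] frame(1)[OF jki] sub(1) card3[OF jki] through[OF jki] sub(2)]
    obtain G where G: "flat_through \<F> {p i, p k, pp j k} G" by (elim exE[rotated])
    note B = flat_A[OF ijk(3)]
    obtain g where g: "g ` model_flat = A i k" "heads g (vertex i) (p i)" "heads g (vertex k) (p k)" "heads g (- vertex i) (D k)"
      using chart[OF ikj ikj B] by blast
    obtain h where h: "h ` model_flat = G" "heads h (vertex i) (p i)" "heads h (vertex k) (p k)" "heads h (- vertex i) (D k)"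
      using chart[OF jki ikj G] by blast
    have fg: "f ` model_flat \<inter> g ` model_flat = f ` cone_at (b j) (vertex i) (vertex k)"
      unfolding f g(1) by (rule inter_frame[OF ikj ikj B])
    have fh: "f ` model_flat \<inter> h ` model_flat = f ` cone_at (b i) (vertex i) (vertex k)"
      unfolding f h(1) by (rule inter_frame[OF jki ikj G])
    obtain \<alpha> \<beta> where \<alpha>\<beta>: "b j - b i = \<alpha> *\<^sub>R vertex i + \<beta> *\<^sub>R vertex k"
      using vertex_decompose[of "b j - b i" i k] b(1) ijk(3) by auto
    then have "b i - b j = (- \<alpha>) *\<^sub>R vertex i + (- \<beta>) *\<^sub>R vertex k" by (simp add: algebra_simps)
    then have "0 \<le> - \<alpha>" by (rule apex_le[OF heads_p heads_p h(2-4) g(4) ijk(3) b(1) b(1) fh fg])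
    moreover have "0 \<le> \<alpha>" by (rule apex_le[OF heads_p heads_p g(2-4) h(4) ijk(3) b(1) b(1) fg fh \<alpha>\<beta>])
    ultimately show ?thesis using \<alpha>\<beta> by auto
  qed
  obtain \<tau> where \<tau>: "b 2 - b 3 = \<tau> *\<^sub>R vertex 1" using parallel[of 3 2 1] by auto
  obtain \<sigma> where \<sigma>: "b 1 - b 3 = \<sigma> *\<^sub>R vertex 2" using parallel[of 3 1 2] by auto
  obtain \<rho> where \<rho>: "b 1 - b 2 = \<rho> *\<^sub>R vertex 3" using parallel[of 2 1 3] by auto
  \<comment> \<open>The differences close up to 0, and the only linear relation among the vertices
    is that their sum is 0; so the three sides share one signed length.\<close>
  have "\<sigma> = - \<tau>"
  proof -
    have "(- \<tau>) *\<^sub>R vertex 1 + \<sigma> *\<^sub>R vertex 2 = (b 1 - b 3) - (b 2 - b 3)" unfolding \<tau> \<sigma> by simp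
    also have "\<dots> = b 1 - b 2" by simp
    also have "\<dots> = (- \<rho>) *\<^sub>R vertex 1 + (- \<rho>) *\<^sub>R vertex 2" unfolding \<rho> vertex_eq(1) by (simp add: algebra_simps)
    finally show ?thesis using vertex_independent[of "- \<tau>" 1 \<sigma> 2 "- \<rho>" "- \<rho>"] by simp
  qed
  then have b1: "b 1 = b 3 - \<tau> *\<^sub>R vertex 2" using \<sigma> by (simp add: algebra_simps)
  have b2: "b 2 = b 3 + \<tau> *\<^sub>R vertex 1" using \<tau> by (simp add: algebra_simps)
  \<comment> \<open>\<open>i + 2\<close> is the index other than \<open>i\<close> and
    \<open>i + 1\<close>, so \<open>y (i + 2)\<close> is the center of the frame to which
    \<open>A i (i + 1)\<close> belongs.\<close>
  have S_eq: "S i = f ` cone_at (b (i + 2)) (vertex i) (vertex (i + 1))" for i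
    unfolding S by (rule inter_frame[OF distinct_succ_3 distinct_succ_3 flat_A[OF distinct_succ_3(1)]])
  have S_sector: "S i = sector \<F> A\<^sub>p (y (i + 2)) (p i) (p (i + 1))" for i
    unfolding S_eq b(2) f[symmetric] by (rule sector_eq[symmetric, OF heads_p heads_p b(1)])
  define C\<^sub>1 C\<^sub>2 C\<^sub>3 T where "C\<^sub>1 = cone_at (b 3) (vertex 1) (vertex 2)"
    and "C\<^sub>2 = cone_at (b 3 - \<tau> *\<^sub>R vertex 2) (vertex 2) (vertex 3)"
    and "C\<^sub>3 = cone_at (b 3 + \<tau> *\<^sub>R vertex 1) (vertex 3) (vertex 1)"
    and "T = convex hull {b 3 - \<tau> *\<^sub>R vertex 2, b 3 + \<tau> *\<^sub>R vertex 1, b 3}"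
  note sets = C\<^sub>1_def C\<^sub>2_def C\<^sub>3_def T_def
  have mod3: "1 + 1 = (2::3)" "1 + 2 = (3::3)" "2 + 1 = (3::3)" "2 + 2 = (1::3)" "3 + 1 = (1::3)" "3 + 2 = (2::3)"
    by simp_all
  have S123: "S 1 = f ` C\<^sub>1" "S 2 = f ` C\<^sub>2" "S 3 = f ` C\<^sub>3"
    unfolding sets b1[symmetric] b2[symmetric]
    by (rule S_eq[of 1, unfolded mod3] S_eq[of 2, unfolded mod3] S_eq[of 3, unfolded mod3])+
  have \<Delta>_eq: "\<Delta> = f ` T"
    using flat_hull_eq[OF f_chart, of "{b 1, b 2, b 3}"] b by (simp add: \<Delta> f T_def b1 b2)
  have sub: "C\<^sub>1 \<subseteq> model_flat" "C\<^sub>2 \<subseteq> model_flat" "C\<^sub>3 \<subseteq> model_flat" "T \<subseteq> model_flat"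
    unfolding sets using b(1) by (intro cone_at_model_flat convex_hull_model_flat; simp)+
  have "C\<^sub>1 \<union> C\<^sub>2 \<union> C\<^sub>3 \<union> T = model_flat"
  proof
    show "model_flat \<subseteq> C\<^sub>1 \<union> C\<^sub>2 \<union> C\<^sub>3 \<union> T"
      unfolding sets using cones_triangle_cover[OF _ b(1)] by (rule subsetI)
  qed (use sub in simp)
  then have cover: "S 1 \<union> S 2 \<union> S 3 \<union> \<Delta> = A\<^sub>p"
    unfolding S123 \<Delta>_eq f[symmetric] by (simp flip: image_Un)
  note thin = cones_triangle_disjoint[OF _ b(1)[of 3], where \<tau> = \<tau>, folded sets]
  let ?int = "\<lambda>X. (top_of_set A\<^sub>p) interior_of X"
  note disjoint = disjoint_interiors[OF f_chart, unfolded f]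
  have vm: "vertex 1 + vertex 2 \<in> model_flat" by simp
  have "?int (S 1) \<inter> ?int (S 2) = {}" unfolding S123 \<Delta>_eq
    by (rule disjoint[OF sub(1,2) vertex_model_flat thin(1)]) (use sub in auto)
  moreover have "?int (S 1) \<inter> ?int (S 3) = {}" unfolding S123 \<Delta>_eq
    by (rule disjoint[OF sub(1,3) vertex_model_flat thin(2)]) (use sub in auto)
  moreover have "?int (S 2) \<inter> ?int (S 3) = {}" unfolding S123 \<Delta>_eq
    by (rule disjoint[OF sub(2,3) vertex_model_flat thin(3)]) (use sub in auto)
  moreover have "?int (S 1) \<inter> ?int (\<Delta>) = {}" unfolding S123 \<Delta>_eq
    by (rule disjoint[OF sub(1,4) vm thin(4)]) (use sub in auto)
  moreover have "?int (S 2) \<inter> ?int (\<Delta>) = {}" unfolding S123 \<Delta>_eq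
    by (rule disjoint[OF sub(2,4) vertex_model_flat thin(5)]) (use sub in auto)
  moreover have "?int (S 3) \<inter> ?int (\<Delta>) = {}" unfolding S123 \<Delta>_eq
    by (rule disjoint[OF sub(3,4) vertex_model_flat thin(6)]) (use sub in auto)
  ultimately show ?thesis using S_sector cover by (auto simp: forall_3)
qed

end
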